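(* Let $\mathfrak{A}\subset\mathcal{A}^{\mathbb{Z}^D}$ be a subshift and let $(\mathcal{G},\cdot)$ be a discrete group. Let $\mathbf{a}\in\widetilde{\mathfrak{A}}$ have a projective codimension-two defect, let $\omega$ be a proper base ray for $\mathbf a$, and define $$\mathrm{Res}_{\mathbf a}:\mathcal{H}^1_{\mathrm{dy}}(\mathfrak{A},\mathcal{G})\times\pi_1(\mathbb{G}_\infty(\mathbf a),\omega)\to\mathcal{G},\qquad \mathrm{Res}_{\mathbf a}(\underline{C},\underline{\zeta}):=C(\zeta,\mathbf a).$$ (a) If $\mathrm{Res}_{\mathbf a}$ is nontrivial (that is, $C(\zeta,\mathbf a)\neq e_{\mathcal G}$ for some $C$ and some $\underline\zeta$), then the codimension-two defect of $\mathbf a$ is essential. (b) If $(\mathcal{G},\cdot)$ is abelian, then $\mathrm{Res}_{\mathbf a}$ is a group homomorphism in each of its two arguments: for fixed $\underline\zeta$ the map $\underline C\mapsto C(\zeta,\mathbf a)$ is a homomorphism $\mathcal{H}^1_{\mathrm{dy}}(\mathfrak{A},\mathcal{G})\to\mathcal{G}$, and for fixed $\underline C$ the map $\underline\zeta\mapsto C(\zeta,\mathbf a)$ is a homomorphism $\pi_1(\mathbb{G}_\infty(\mathbf a),\omega)\to\mathcal{G}$.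
   Context: **Subshifts.** $\mathcal{A}$ is a finite alphabet, $D\ge1$; $\mathcal{A}^{\mathbb{Z}^D}$ carries the product topology; $\sigma^{\mathsf v}(\mathbf a)_{\mathsf z}=a_{\mathsf z+\mathsf v}$. A subshift is a closed set $\mathfrak{A}\subset\mathcal{A}^{\mathbb{Z}^D}$ with $\sigma^{\mathsf z}(\mathfrak{A})=\mathfrak{A}$ for all $\mathsf z$. $\mathbb{B}(r)=\{-r,\dots,r\}^D$, $\mathbb{B}(\mathsf z,r)=\mathsf z+\mathbb{B}(r)$; $\mathbf a_{\mathbb U}$ is the restriction of $\mathbf a$ to $\mathbb U$, patterns on translates of $\mathbb U$ being identified with patterns on $\mathbb U$; $\mathfrak{A}_{(r)}=\{\mathbf a_{\mathbb{B}(r)}:\mathbf a\in\mathfrak{A}\}$. **Defects.** $\mathcal{F}_{\mathbf a}(\mathsf z)=\max\{r\in\mathbb N:\mathbf a_{\mathbb{B}(\mathsf z,r)}\in\mathfrak{A}_{(r)}\}\in\mathbb N\cup\{\infty\}$; $\widetilde{\mathfrak{A}}=\{\mathbf a\in\mathcal{A}^{\mathbb{Z}^D}:\sup_{\mathsf z}\mathcal{F}_{\mathbf a}(\mathsf z)=\infty\}$; $\mathbb{G}_r(\mathbf a)=\{\mathsf z:\mathcal{F}_{\mathbf a}(\mathsf z)\ge r\}$. The defect of $\mathbf a$ is essential if there are no $r>0$ and $\mathbf a'\in\mathfrak{A}$ with $a'_{\mathsf z}=a_{\mathsf z}$ for all $\mathsf z\in\mathbb{G}_r(\mathbf a)$.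 **Proper fundamental group.** A trail is a finite sequence $\zeta=(\mathsf z_0,\dots,\mathsf z_N)$ in $\mathbb{Z}^D$ with $\mathsf z_n-\mathsf z_{n-1}\in\mathbb E:=\{\pm\mathsf e_1,\dots,\pm\mathsf e_D\}$; it is closed if $\mathsf z_N=\mathsf z_0$. Connected components of subsets of $\mathbb{Z}^D$ are taken with respect to trails. For $\mathbb Y\subset\mathbb{Z}^D$, $\mathbf Y\subset\mathbb{R}^D$ is the union of all unit cubes $\mathsf z+[0,1]^D$ ($\mathsf z\in\mathbb{Z}^D$) all of whose corners lie in $\mathbb Y$. A connected component $\mathbb Y$ of $\mathbb{G}_{r}(\mathbf a)$ is projective if $\mathbb Y\cap\mathbb{G}_R(\mathbf a)\ne\emptyset$ for all $R\ge r$. It is assumed that for some $r_0$, $\mathbb{G}_{r_0}(\mathbf a)$ has a unique projective component $\mathbb Y$, and that for $r>r_0$ the set $\mathbb Y_r:=\mathbb Y\cap\mathbb{G}_r(\mathbf a)$ is the unique projective component of $\mathbb{G}_r(\mathbf a)$. A proper base ray is a continuous path $\omega:[0,\infty)\to\mathbf Y_{r_0}$ with $|\omega(t)|\to\infty$, lying in $\mathbf Y_r$ for all sufficiently large $t$, for every $r$. Put $\pi_1(\mathbb Y_r,\omega):=\pi_1(\mathbf Y_r,\omega(t))$ for $t$ large (different $t$ identified along segments of $\omega$), and $\pi_1(\mathbb{G}_\infty(\mathbf a),\omega):=\varprojlim_r\pi_1(\mathbb Y_r,\omega)$ with respect to the maps induced by inclusions $\mathbb Y_{r+1}\subset\mathbb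 Y_r$. $\mathbf a$ has a projective codimension-two defect if this group is nontrivial. **Cocycles.** A ($\mathcal G$-valued, dynamical) cocycle on $\mathfrak A$ is a continuous $C:\mathbb{Z}^D\times\mathfrak{A}\to\mathcal{G}$ with $C(\mathsf y+\mathsf z,\mathbf a)=C(\mathsf y,\sigma^{\mathsf z}(\mathbf a))\cdot C(\mathsf z,\mathbf a)$. $C\approx C'$ (cohomologous) if there is a continuous $b:\mathfrak A\to\mathcal G$ with $C'(\mathsf z,\mathbf a)=b(\sigma^{\mathsf z}(\mathbf a))\,C(\mathsf z,\mathbf a)\,b(\mathbf a)^{-1}$. $\underline C$ is the class of $C$. $C$ is trivial if it is cohomologous to a cocycle of the form $(\mathsf z,\mathbf a)\mapsto h(\mathsf z)$ with $h:\mathbb{Z}^D\to\mathcal G$ a homomorphism. If $\mathcal G$ is abelian, $\mathcal{H}^1_{\mathrm{dy}}(\mathfrak A,\mathcal G)$ is the group of cocycles (pointwise multiplication) modulo the subgroup of trivial cocycles; if $\mathcal G$ is nonabelian it is the set of cohomology classes of cocycles. **The value $C(\zeta,\mathbf a)$.** As $\mathcal G$ is discrete, every cocycle $C$ is locally determined: there are $r>0$ and a local rule $c:\mathbb E\times\mathfrak{A}_{(r)}\to\mathcal G$ with $C(\mathsf e,\mathbf b)=c(\mathsf e,\mathbf b_{\mathbb B(r)})$ for $\mathbf b\in\mathfrak A$. For a trail $\zeta=(\mathsf z_0,\dots,\mathsf z_N)$ in $\mathbb{G}_r(\mathbf a)$ set, with $\mathsf z'_n=\mathsf z_n-\mathsf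 z_{n-1}$, $$C(\zeta,\mathbf a):=c(\mathsf z'_N,\mathbf a_{\mathbb B(\mathsf z_{N-1},r)})\cdots c(\mathsf z'_2,\mathbf a_{\mathbb B(\mathsf z_{1},r)})\,c(\mathsf z'_1,\mathbf a_{\mathbb B(\mathsf z_0,r)}).$$ For $\underline\zeta\in\pi_1(\mathbb{G}_\infty(\mathbf a),\omega)$, $C(\zeta,\mathbf a)$ means $C(\zeta_s,\mathbf a)$, where $s$ is sufficiently large and $\zeta_s$ is a closed trail in $\mathbb Y_s$ representing (up to change of base point) the component of $\underline\zeta$ in $\pi_1(\mathbb Y_s,\omega)$. It is determined by $\underline C$ and $\underline\zeta$ when $\mathcal G$ is abelian, and up to conjugacy in general, so whether it equals $e_{\mathcal G}$ is unambiguous. *)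

theory Defs
  imports "HOL-Analysis.Analysis" "HOL-Algebra.Product_Groups"
begin

section \<open>Subshifts\<close>

text \<open>The lattice is \<open>int ^ 'd\<close>, so \<open>D = CARD('d)\<close>; the finite alphabet is a type of class \<open>finite\<close>.\<close>

type_synonym ('a, 'd) config = "int ^ 'd \<Rightarrow> 'a"

definition config_topology :: "('a, 'd::finite) config topology" where
  "config_topology = product_topology (\<lambda>_. discrete_topology UNIV) UNIV"

definition shift :: "int ^ 'd \<Rightarrow> ('a, 'd::finite) config \<Rightarrow> ('a, 'd::finite) config" where
  "shift v a = (\<lambda>z. a (z + v))"

definition subshift :: "('a::finite, 'd::finite) config set \<Rightarrow> bool" where
  "subshift A \<longleftrightarrow> closedin config_topology A \<and> (\<forall>z. shift z ` A = A)"

definition box0 :: "nat \<Rightarrow> (int ^ 'd) set" where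
  "box0 r = {z. \<forall>i. \<bar>z $ i\<bar> \<le> int r}"

text \<open>The pattern of \<open>a\<close> on the box of radius \<open>r\<close> around \<open>z\<close>, translated back to the box around
  the origin.\<close>

definition pattern :: "('a, 'd::finite) config \<Rightarrow> int ^ 'd \<Rightarrow> nat \<Rightarrow> ('a, 'd::finite) config" where
  "pattern a z r = restrict (shift z a) (box0 r)"

definition admissible :: "('a, 'd::finite) config set \<Rightarrow> nat \<Rightarrow> ('a, 'd::finite) config set" where
  "admissible A r = (\<lambda>b. restrict b (box0 r)) ` A"

section \<open>Defects\<close>

text \<open>The supremum in \<open>enat\<close> is the maximum, or \<open>\<infinity>\<close> if there is none; for the empty set (the
  letter at \<open>z\<close> does not occur in \<open>A\<close>) it is \<open>0\<close>. Since \<open>A\<close> is a subshift the set is downward closed.\<close>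

definition admissible_radius :: "('a, 'd::finite) config set \<Rightarrow> ('a, 'd::finite) config \<Rightarrow> int ^ 'd \<Rightarrow> enat" where
  "admissible_radius A a z = Sup {enat r | r. pattern a z r \<in> admissible A r}"

definition defect_configs :: "('a, 'd::finite) config set \<Rightarrow> ('a, 'd::finite) config set" where
  "defect_configs A = {a. (SUP z. admissible_radius A a z) = \<infinity>}"

definition good_sites :: "('a, 'd::finite) config set \<Rightarrow> ('a, 'd::finite) config \<Rightarrow> nat \<Rightarrow> (int ^ 'd) set" where
  "good_sites A a r = {z. enat r \<le> admissible_radius A a z}"

definition essential_defect :: "('a, 'd::finite) config set \<Rightarrow> ('a, 'd::finite) config \<Rightarrow> bool" where
  "essential_defect A a \<longleftrightarrow>
     \<not> (\<exists>r>0. \<exists>a'\<in>A. \<forall>z\<in>good_sites A a r. a' z = a z)"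

section \<open>Trails and projective components\<close>

definition unit_steps :: "(int ^ 'd) set" where
  "unit_steps = (\<Union>i. {axis i 1, - axis i 1})"

definition trail_in :: "(int ^ 'd) set \<Rightarrow> (int ^ 'd) list \<Rightarrow> bool" where
  "trail_in S zs \<longleftrightarrow> zs \<noteq> [] \<and> set zs \<subseteq> S \<and>
     (\<forall>n. Suc n < length zs \<longrightarrow> zs ! Suc n - zs ! n \<in> unit_steps)"

definition closed_trail_in :: "(int ^ 'd) set \<Rightarrow> (int ^ 'd) list \<Rightarrow> bool" where
  "closed_trail_in S zs \<longleftrightarrow> trail_in S zs \<and> last zs = hd zs"

definition trail_components :: "(int ^ 'd) set \<Rightarrow> (int ^ 'd) set set" where
  "trail_components S = {{y. \<exists>zs. trail_in S zs \<and> hd zs = x \<and> last zs = y} | x. x \<in> S}"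

definition projective_component ::
    "('a, 'd::finite) config set \<Rightarrow> ('a, 'd::finite) config \<Rightarrow> nat \<Rightarrow> (int ^ 'd) set \<Rightarrow> bool" where
  "projective_component A a r Z \<longleftrightarrow>
     Z \<in> trail_components (good_sites A a r) \<and> (\<forall>R\<ge>r. Z \<inter> good_sites A a R \<noteq> {})"

text \<open>The standing assumption on \<open>a\<close>, for the threshold \<open>r0\<close> and the component \<open>Y\<close>.\<close>

definition unique_projective ::
    "('a, 'd::finite) config set \<Rightarrow> ('a, 'd::finite) config \<Rightarrow> nat \<Rightarrow> (int ^ 'd) set \<Rightarrow> bool" where
  "unique_projective A a r0 Y \<longleftrightarrow>
     (\<forall>Z. projective_component A a r0 Z \<longleftrightarrow> Z = Y) \<and>
     (\<forall>r>r0. \<forall>Z. projective_component A a r Z \<longleftrightarrow> Z = Y \<inter> good_sites A a r)"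

section \<open>The proper fundamental group\<close>

definition lattice_point :: "int ^ 'd \<Rightarrow> real ^ 'd" where
  "lattice_point z = (\<chi> i. real_of_int (z $ i))"

definition cube_corners :: "int ^ 'd \<Rightarrow> (int ^ 'd) set" where
  "cube_corners z = {w. \<forall>i. w $ i = z $ i \<or> w $ i = z $ i + 1}"

definition cube_complex :: "(int ^ 'd) set \<Rightarrow> (real ^ 'd::finite) set" where
  "cube_complex Y = \<Union>{cbox (lattice_point z) (lattice_point (z + 1)) | z. cube_corners z \<subseteq> Y}"

definition level_complex ::
    "('a, 'd::finite) config set \<Rightarrow> ('a, 'd::finite) config \<Rightarrow> (int ^ 'd) set \<Rightarrow> nat \<Rightarrow> (real ^ 'd::finite) set" where
  "level_complex A a Y r = cube_complex (Y \<inter> good_sites A a r)"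

text \<open>The fundamental group of \<open>S\<close> at \<open>p\<close>. Paths are functions on \<open>real\<close> of which only the values
  on \<open>{0..1}\<close> matter; classes are taken for \<^const>\<open>homotopic_paths\<close>, which fixes end points.\<close>

definition path_class :: "'p::topological_space set \<Rightarrow> (real \<Rightarrow> 'p) \<Rightarrow> (real \<Rightarrow> 'p) set" where
  "path_class S g = {h. homotopic_paths S g h}"

definition pi1 :: "'p::real_normed_vector set \<Rightarrow> 'p \<Rightarrow> (real \<Rightarrow> 'p) set monoid" where
  "pi1 S p =
     \<lparr>carrier = {path_class S g | g. path g \<and> path_image g \<subseteq> S \<and> pathstart g = p \<and> pathfinish g = p},
      mult = (\<lambda>X Y. \<Union>g\<in>X. \<Union>h\<in>Y. path_class S (g +++ h)),
      one = path_class S (linepath p p)\<rparr>"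

text \<open>The map into \<open>pi1 S p\<close> induced by the inclusion of a subset containing \<open>p\<close>.\<close>

definition pi1_incl :: "'p::topological_space set \<Rightarrow> (real \<Rightarrow> 'p) set \<Rightarrow> (real \<Rightarrow> 'p) set" where
  "pi1_incl S X = (\<Union>g\<in>X. path_class S g)"

text \<open>Change of base point from the start to the end of the path \<open>q\<close>.\<close>

definition pi1_transport ::
    "'p::topological_space set \<Rightarrow> (real \<Rightarrow> 'p) \<Rightarrow> (real \<Rightarrow> 'p) set \<Rightarrow> (real \<Rightarrow> 'p) set" where
  "pi1_transport S q X = (\<Union>g\<in>X. path_class S (reversepath q +++ g +++ q))"

definition proper_base_ray ::
    "('a, 'd::finite) config set \<Rightarrow> ('a, 'd::finite) config \<Rightarrow> nat \<Rightarrow> (int ^ 'd) set \<Rightarrow> (real \<Rightarrow> real ^ 'd::finite) \<Rightarrow> bool" where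
  "proper_base_ray A a r0 Y \<omega> \<longleftrightarrow>
     continuous_on {0..} \<omega> \<and> \<omega> ` {0..} \<subseteq> level_complex A a Y r0 \<and>
     filterlim (\<lambda>t. norm (\<omega> t)) at_top at_top \<and>
     (\<forall>r\<ge>r0. \<forall>\<^sub>F t in at_top. \<omega> t \<in> level_complex A a Y r)"

text \<open>The base points \<open>\<omega> t\<close> with \<open>t\<close> so large that the rest of the ray stays in \<open>S\<close>.\<close>

definition base_times :: "'p set \<Rightarrow> (real \<Rightarrow> 'p) \<Rightarrow> real set" where
  "base_times S \<omega> = {t. 0 \<le> t \<and> \<omega> ` {t..} \<subseteq> S}"

text \<open>The group based at the end of the ray. The identification of the groups \<open>pi1 S (\<omega> t)\<close> along
  the segments of \<open>\<omega>\<close> is expressed without choosing a \<open>t\<close>: an element is a family of classes, one at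
  each such \<open>t\<close>, that correspond to each other under these identifications. Evaluation at any single
  \<open>t\<close> is an isomorphism onto \<open>pi1 S (\<omega> t)\<close>.\<close>

definition pi1_ray ::
    "'p::real_normed_vector set \<Rightarrow> (real \<Rightarrow> 'p) \<Rightarrow> (real \<Rightarrow> (real \<Rightarrow> 'p) set) monoid" where
  "pi1_ray S \<omega> =
     (let P = product_group (base_times S \<omega>) (\<lambda>t. pi1 S (\<omega> t)) in
      P\<lparr>carrier := {x \<in> carrier P. \<forall>t\<in>base_times S \<omega>. \<forall>t'\<in>base_times S \<omega>.
                      t \<le> t' \<longrightarrow> x t' = pi1_transport S (subpath t t' \<omega>) (x t)}\<rparr>)"

text \<open>The inverse limit over \<open>r \<ge> r0\<close>: compatibility with the inclusion of level \<open>r + 1\<close> into level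
  \<open>r\<close> is tested at the base points available on both levels, that is, on level \<open>r + 1\<close>.\<close>

definition pi1_infinity ::
    "('a, 'd::finite) config set \<Rightarrow> ('a, 'd::finite) config \<Rightarrow> nat \<Rightarrow> (int ^ 'd) set \<Rightarrow> (real \<Rightarrow> real ^ 'd::finite)
       \<Rightarrow> (nat \<Rightarrow> real \<Rightarrow> (real \<Rightarrow> real ^ 'd) set) monoid" where
  "pi1_infinity A a r0 Y \<omega> =
     (let P = product_group {r0..} (\<lambda>r. pi1_ray (level_complex A a Y r) \<omega>) in
      P\<lparr>carrier := {\<xi> \<in> carrier P. \<forall>r\<ge>r0. \<forall>t\<in>base_times (level_complex A a Y (Suc r)) \<omega>.
                      \<xi> r t = pi1_incl (level_complex A a Y r) (\<xi> (Suc r) t)}\<rparr>)"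

definition projective_codim2_defect :: "('a, 'd::finite) config set \<Rightarrow> ('a, 'd::finite) config \<Rightarrow> bool" where
  "projective_codim2_defect A a \<longleftrightarrow>
     (\<exists>r0 Y \<omega>. unique_projective A a r0 Y \<and> proper_base_ray A a r0 Y \<omega> \<and>
        carrier (pi1_infinity A a r0 Y \<omega>) \<noteq> {\<one>\<^bsub>pi1_infinity A a r0 Y \<omega>\<^esub>})"

section \<open>Cocycles\<close>

type_synonym ('a, 'd, 'g) cochain = "(int ^ 'd) \<times> ('a, 'd) config \<Rightarrow> 'g"

text \<open>A cocycle is a function on \<open>UNIV \<times> A\<close>, made extensional so that equality is equality on this
  set.\<close>

definition cocycles ::
    "('a, 'd::finite) config set \<Rightarrow> ('g, 'm) monoid_scheme \<Rightarrow> ('a, 'd::finite, 'g) cochain set" where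
  "cocycles A G =
     {C \<in> extensional (UNIV \<times> A).
        continuous_map (prod_topology (discrete_topology UNIV) (subtopology config_topology A))
          (discrete_topology (carrier G)) C \<and>
        (\<forall>y z. \<forall>a\<in>A. C (y + z, a) = C (y, shift z a) \<otimes>\<^bsub>G\<^esub> C (z, a))}"

definition cohomologous ::
    "('a, 'd::finite) config set \<Rightarrow> ('g, 'm) monoid_scheme \<Rightarrow> ('a, 'd::finite, 'g) cochain
       \<Rightarrow> ('a, 'd::finite, 'g) cochain \<Rightarrow> bool" where
  "cohomologous A G C C' \<longleftrightarrow>
     (\<exists>b. continuous_map (subtopology config_topology A) (discrete_topology (carrier G)) b \<and>
        (\<forall>z. \<forall>a\<in>A. C' (z, a) = b (shift z a) \<otimes>\<^bsub>G\<^esub> C (z, a) \<otimes>\<^bsub>G\<^esub> inv\<^bsub>G\<^esub> b a))"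

definition lattice_group :: "(int ^ 'd) monoid" where
  "lattice_group = \<lparr>carrier = UNIV, mult = (+), one = 0\<rparr>"

definition trivial_cocycles ::
    "('a, 'd::finite) config set \<Rightarrow> ('g, 'm) monoid_scheme \<Rightarrow> ('a, 'd::finite, 'g) cochain set" where
  "trivial_cocycles A G =
     {C \<in> cocycles A G. \<exists>h\<in>hom lattice_group G. cohomologous A G C (\<lambda>(z, a). h z)}"

definition cocycle_group ::
    "('a, 'd::finite) config set \<Rightarrow> ('g, 'm) monoid_scheme \<Rightarrow> ('a, 'd::finite, 'g) cochain monoid" where
  "cocycle_group A G =
     \<lparr>carrier = cocycles A G,
      mult = (\<lambda>C C'. \<lambda>p\<in>UNIV \<times> A. C p \<otimes>\<^bsub>G\<^esub> C' p),
      one = (\<lambda>p\<in>UNIV \<times> A. \<one>\<^bsub>G\<^esub>)\<rparr>"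

text \<open>The first dynamical cohomology group; meant for abelian \<open>G\<close>.\<close>

definition H1_dy ::
    "('a, 'd::finite) config set \<Rightarrow> ('g, 'm) monoid_scheme \<Rightarrow> ('a, 'd::finite, 'g) cochain set monoid" where
  "H1_dy A G = cocycle_group A G Mod trivial_cocycles A G"

section \<open>Residues\<close>

definition local_rule ::
    "('a, 'd::finite) config set \<Rightarrow> ('a, 'd::finite, 'g) cochain \<Rightarrow> nat
       \<Rightarrow> (int ^ 'd \<Rightarrow> ('a, 'd::finite) config \<Rightarrow> 'g) \<Rightarrow> bool" where
  "local_rule A C r c \<longleftrightarrow>
     r > 0 \<and> (\<forall>e\<in>unit_steps. \<forall>b\<in>A. C (e, b) = c e (restrict b (box0 r)))"

text \<open>Later steps of the trail multiply from the left.\<close>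

fun trail_value ::
    "('g, 'm) monoid_scheme \<Rightarrow> (int ^ 'd \<Rightarrow> ('a, 'd::finite) config \<Rightarrow> 'g) \<Rightarrow> nat \<Rightarrow> ('a, 'd::finite) config
       \<Rightarrow> (int ^ 'd) list \<Rightarrow> 'g" where
  "trail_value G c r a (y # z # zs) =
     trail_value G c r a (z # zs) \<otimes>\<^bsub>G\<^esub> c (z - y) (pattern a y r)"
| "trail_value G c r a _ = \<one>\<^bsub>G\<^esub>"

text \<open>The polygonal path along a trail; its value on the empty list is irrelevant.\<close>

fun trail_path :: "(int ^ 'd) list \<Rightarrow> real \<Rightarrow> real ^ 'd" where
  "trail_path [] = (\<lambda>_. 0)"
| "trail_path [z] = linepath (lattice_point z) (lattice_point z)"
| "trail_path (y # z # zs) = linepath (lattice_point y) (lattice_point z) +++ trail_path (z # zs)"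

text \<open>The closed trail \<open>zs\<close> on level \<open>s\<close> represents the level-\<open>s\<close> component of \<open>\<xi>\<close>, the base point
  being changed along a path \<open>q\<close> from the ray to the start of \<open>zs\<close>. Membership in the class forces
  the polygonal path of \<open>zs\<close> to lie in the level complex.\<close>

definition represents ::
    "('a, 'd::finite) config set \<Rightarrow> ('a, 'd::finite) config \<Rightarrow> (int ^ 'd) set \<Rightarrow> (real \<Rightarrow> real ^ 'd::finite) \<Rightarrow> nat
       \<Rightarrow> (nat \<Rightarrow> real \<Rightarrow> (real \<Rightarrow> real ^ 'd) set) \<Rightarrow> (int ^ 'd) list \<Rightarrow> bool" where
  "represents A a Y \<omega> s \<xi> zs \<longleftrightarrow>
     closed_trail_in (Y \<inter> good_sites A a s) zs \<and>
     (\<exists>t\<in>base_times (level_complex A a Y s) \<omega>. \<exists>q.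
        path q \<and> path_image q \<subseteq> level_complex A a Y s \<and>
        pathstart q = \<omega> t \<and> pathfinish q = lattice_point (hd zs) \<and>
        (q +++ trail_path zs +++ reversepath q) \<in> \<xi> s t)"

text \<open>\<open>g\<close> is a value of the cocycle \<open>C\<close> on \<open>\<xi>\<close>: for all large \<open>s\<close> it is, up to conjugacy, the value
  on a trail that represents \<open>\<xi>\<close> on level \<open>s\<close>. Conjugation is needed for nonabelian \<open>G\<close> only, where the
  base point of the trail has to move to infinity with \<open>s\<close>.\<close>

definition cocycle_value ::
    "('a, 'd::finite) config set \<Rightarrow> ('g, 'm) monoid_scheme \<Rightarrow> ('a, 'd::finite) config \<Rightarrow> (int ^ 'd) set
       \<Rightarrow> (real \<Rightarrow> real ^ 'd::finite) \<Rightarrow> ('a, 'd::finite, 'g) cochain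
       \<Rightarrow> (nat \<Rightarrow> real \<Rightarrow> (real \<Rightarrow> real ^ 'd) set) \<Rightarrow> 'g \<Rightarrow> bool" where
  "cocycle_value A G a Y \<omega> C \<xi> g \<longleftrightarrow>
     (\<exists>r c. local_rule A C r c \<and>
        (\<forall>\<^sub>F s in sequentially. \<exists>zs. represents A a Y \<omega> s \<xi> zs \<and>
           (\<exists>x\<in>carrier G. g = x \<otimes>\<^bsub>G\<^esub> trail_value G c r a zs \<otimes>\<^bsub>G\<^esub> inv\<^bsub>G\<^esub> x)))"

text \<open>The residue on cohomology classes, for abelian \<open>G\<close>.\<close>

definition Res ::
    "('a, 'd::finite) config set \<Rightarrow> ('g, 'm) monoid_scheme \<Rightarrow> ('a, 'd::finite) config \<Rightarrow> (int ^ 'd) set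
       \<Rightarrow> (real \<Rightarrow> real ^ 'd::finite) \<Rightarrow> ('a, 'd::finite, 'g) cochain set
       \<Rightarrow> (nat \<Rightarrow> real \<Rightarrow> (real \<Rightarrow> real ^ 'd) set) \<Rightarrow> 'g" where
  "Res A G a Y \<omega> X \<xi> = (THE g. \<exists>C\<in>X. cocycle_value A G a Y \<omega> C \<xi> g)"

end

theory Submission
  imports Defs
begin

text \<open>
  A cocycle \<open>C\<close> turns \<open>a\<close> into a flat \<open>G\<close>-valued connection on the level complexes: if \<open>u\<close> is a site
  near which \<open>a\<close> agrees on a large box with a point \<open>b\<close> of the subshift, then moving from \<open>u\<close> to a
  nearby site \<open>v\<close> has the transition value \<open>C(v - u, b)\<close>, and the cocycle identity says that these
  values multiply whenever three points are close together. Assigning to each point of the complex its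
  nearest lattice point, one obtains a holonomy of arbitrary continuous paths, which is invariant
  under homotopy and equals \<open>C(\<zeta>, a)\<close> on the polygonal path of a trail \<open>\<zeta>\<close>. The holonomy is multiplicative
  in the path and, for abelian \<open>G\<close>, in the cocycle; a trivial cocycle has a potential. Conversely every
  loop of the complex is homotopic to a trail, because the open star of a lattice point in the complex is
  star-shaped. If the defect is not essential, a single point of the subshift extends \<open>a\<close> from the trail, and
  the value on a closed trail telescopes to \<open>C(0, b) = 1\<close>.
\<close>

section \<open>Holonomy of a locally consistent transition function\<close>

text \<open>A homotopy in the complex leaves the lattice, and a purely combinatorial treatment would
  have to cut it into elementary moves of trails. With holonomy of continuous paths, flatness is
  checked once, for triples of points within a fixed distance, and a homotopy is handled by one
  section over the square. Rounding to the lattice is discontinuous, but only consistency at scale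
  \<open>\<delta>\<close> enters.

  For cocycles the scale is 2. It exceeds 1, the length of an edge of a trail, so that a whole edge
  is one short path; and points closer than 2 round to sites that differ by at most 2 in each
  coordinate. Hence the box of radius 2 in \<open>window\<close> and the level \<open>R + 2\<close>.

  The level \<open>s\<close> of the transition function depends on the cocycle only, while
  representing trails live on arbitrarily deep levels and may be evaluated by a local rule of larger
  radius. Values are therefore computed at the fixed level and compared with deep trails through
  inclusions. Conjugations from moving the base point disappear by commutativity; part (a) works
  with the telescoping product of a single trail.\<close>

locale local_transition = group G for G (structure) +
  fixes X :: "'p::metric_space set" and \<delta> :: real and T :: "'p \<Rightarrow> 'p \<Rightarrow> 'a"
  assumes delta_pos: "\<delta> > 0"
    and T_closed: "\<lbrakk>x \<in> X; y \<in> X; dist x y < \<delta>\<rbrakk> \<Longrightarrow> T x y \<in> carrier G"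
    and T_trans: "\<lbrakk>x \<in> X; y \<in> X; z \<in> X; dist x y < \<delta>; dist y z < \<delta>; dist x z < \<delta>\<rbrakk>
      \<Longrightarrow> T x z = T y z \<otimes> T x y"
begin

lemma T_refl: "x \<in> X \<Longrightarrow> T x x = \<one>"
  using T_trans[of x x x] T_closed[of x x] delta_pos
  by (metis dist_self l_cancel_one')

text \<open>The sections along \<open>f\<close> of the flat bundle that \<open>T\<close> defines.
  The base \<open>K\<close> is an arbitrary metric space so that the same notion serves for a path
  (an interval) and for a homotopy (the unit square).\<close>

definition parallel :: "'k::metric_space set \<Rightarrow> ('k \<Rightarrow> 'p) \<Rightarrow> ('k \<Rightarrow> 'a) \<Rightarrow> bool" where
  "parallel K f \<phi> \<longleftrightarrow> (\<forall>x\<in>K. \<phi> x \<in> carrier G) \<and>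
     (\<exists>\<epsilon>>0. \<forall>x\<in>K. \<forall>y\<in>K. dist x y < \<epsilon> \<longrightarrow> dist (f x) (f y) < \<delta> \<and> \<phi> y = T (f x) (f y) \<otimes> \<phi> x)"

lemma parallelI:
  assumes "\<epsilon> > 0" and "\<And>x. x \<in> K \<Longrightarrow> \<phi> x \<in> carrier G"
    and "\<And>x y. \<lbrakk>x \<in> K; y \<in> K; dist x y < \<epsilon>\<rbrakk> \<Longrightarrow> dist (f x) (f y) < \<delta>"
    and "\<And>x y. \<lbrakk>x \<in> K; y \<in> K; dist x y < \<epsilon>\<rbrakk> \<Longrightarrow> \<phi> y = T (f x) (f y) \<otimes> \<phi> x"
  shows "parallel K f \<phi>"
  unfolding parallel_def using assms by blast

lemma parallelE:
  assumes "parallel K f \<phi>"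
  obtains \<epsilon> where "\<epsilon> > 0" and "\<And>x y. \<lbrakk>x \<in> K; y \<in> K; dist x y < \<epsilon>\<rbrakk> \<Longrightarrow> dist (f x) (f y) < \<delta>"
    and "\<And>x y. \<lbrakk>x \<in> K; y \<in> K; dist x y < \<epsilon>\<rbrakk> \<Longrightarrow> \<phi> y = T (f x) (f y) \<otimes> \<phi> x"
  using assms unfolding parallel_def by blast

lemma parallel_closed: "parallel K f \<phi> \<Longrightarrow> x \<in> K \<Longrightarrow> \<phi> x \<in> carrier G"
  by (simp add: parallel_def)

lemma parallel_cong:
  assumes "parallel K f \<phi>" and "\<And>x. x \<in> K \<Longrightarrow> f x = g x"
  shows "parallel K g \<phi>"
proof -
  obtain \<epsilon> where "\<epsilon> > 0" and "\<And>x y. \<lbrakk>x \<in> K; y \<in> K; dist x y < \<epsilon>\<rbrakk> \<Longrightarrow> dist (f x) (f y) < \<delta>"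
    and "\<And>x y. \<lbrakk>x \<in> K; y \<in> K; dist x y < \<epsilon>\<rbrakk> \<Longrightarrow> \<phi> y = T (f x) (f y) \<otimes> \<phi> x"
    by (rule parallelE[OF assms(1)]) (rule that)
  then show ?thesis
    using parallel_closed[OF assms(1)] by (intro parallelI[of \<epsilon>]) (simp_all only: assms(2)[symmetric])
qed

text \<open>Pullback of a section. It yields the halves of a concatenation, the reversal of a path
  and the sides of a homotopy square.\<close>

lemma parallel_compose:
  assumes "parallel K f \<phi>" and "uniformly_continuous_on L \<alpha>" and "\<alpha> ` L \<subseteq> K"
  shows "parallel L (f \<circ> \<alpha>) (\<phi> \<circ> \<alpha>)"
proof -
  obtain \<epsilon> where \<epsilon>: "\<epsilon> > 0" "\<And>x y. \<lbrakk>x \<in> K; y \<in> K; dist x y < \<epsilon>\<rbrakk> \<Longrightarrow> dist (f x) (f y) < \<delta>"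
    "\<And>x y. \<lbrakk>x \<in> K; y \<in> K; dist x y < \<epsilon>\<rbrakk> \<Longrightarrow> \<phi> y = T (f x) (f y) \<otimes> \<phi> x"
    by (rule parallelE[OF assms(1)]) (rule that)
  obtain d where "d > 0" "\<And>x y. \<lbrakk>x \<in> L; y \<in> L; dist y x < d\<rbrakk> \<Longrightarrow> dist (\<alpha> y) (\<alpha> x) < \<epsilon>"
    using assms(2) \<epsilon>(1) unfolding uniformly_continuous_on_def by meson
  then show ?thesis
    using assms(3) parallel_closed[OF assms(1)]
    by (intro parallelI[of d]) (auto simp: image_subset_iff dist_commute intro: \<epsilon>)
qed

text \<open>\<open>T\<close> acts from the left, so right translation commutes with it; this gives
  the freedom to prescribe the value of a section at one point.\<close>

lemma parallel_mult_right:
  assumes "parallel K f \<phi>" and "f ` K \<subseteq> X" and "g \<in> carrier G"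
  shows "parallel K f (\<lambda>x. \<phi> x \<otimes> g)"
proof -
  obtain \<epsilon> where \<epsilon>: "\<epsilon> > 0" "\<And>x y. \<lbrakk>x \<in> K; y \<in> K; dist x y < \<epsilon>\<rbrakk> \<Longrightarrow> dist (f x) (f y) < \<delta>"
    "\<And>x y. \<lbrakk>x \<in> K; y \<in> K; dist x y < \<epsilon>\<rbrakk> \<Longrightarrow> \<phi> y = T (f x) (f y) \<otimes> \<phi> x"
    by (rule parallelE[OF assms(1)]) (rule that)
  show ?thesis
  proof (rule parallelI[OF \<epsilon>(1)])
    fix x y assume xy: "x \<in> K" "y \<in> K" "dist x y < \<epsilon>"
    then show "\<phi> y \<otimes> g = T (f x) (f y) \<otimes> (\<phi> x \<otimes> g)"
      using \<epsilon>(3)[OF xy] T_closed[OF _ _ \<epsilon>(2)[OF xy]] assms(2,3) parallel_closed[OF assms(1) xy(1)]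
      by (simp add: image_subset_iff m_assoc)
  qed (use \<epsilon>(2) assms parallel_closed[OF assms(1)] in auto)
qed

text \<open>Transport from a fixed point \<open>x0\<close> along straight segments, cut into \<open>n\<close> short steps; the
  segments to two nearby points run parallel at short distance, so the values match.\<close>

lemma parallel_exists:
  fixes K :: "'k::real_normed_vector set"
  assumes "convex K" and "compact K" and "continuous_on K f" and "f ` K \<subseteq> X"
  shows "\<exists>\<phi>. parallel K f \<phi>"
proof (cases "K = {}")
  case True
  then show ?thesis by (auto simp: parallel_def intro: exI[of _ 1])
next
  case False
  then obtain x0 where x0: "x0 \<in> K" by auto
  have "uniformly_continuous_on K f"
    using assms compact_uniformly_continuous by blast
  then obtain \<epsilon> where \<epsilon>: "\<epsilon> > 0" "\<And>x y. \<lbrakk>x \<in> K; y \<in> K; dist x y < \<epsilon>\<rbrakk> \<Longrightarrow> dist (f x) (f y) < \<delta>"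
    using delta_pos unfolding uniformly_continuous_on_def by (metis dist_commute)
  obtain M where M: "M > 0" "\<And>x. x \<in> K \<Longrightarrow> norm (x - x0) \<le> M"
  proof -
    have "bounded ((\<lambda>x. x - x0) ` K)"
      using compact_imp_bounded[OF assms(2)] by (rule bounded_translation_minus)
    then show ?thesis using that unfolding bounded_pos by blast
  qed
  \<comment> \<open>With this \<open>n\<close> each step is shorter than
    \<open>\<epsilon> / 2\<close>, so a step along one segment combined with a step across to the
    other stays below \<open>\<epsilon>\<close>.\<close>
  obtain n :: nat where n: "real n > 2 * M / \<epsilon>" "n > 0"
  proof -
    obtain n :: nat where "real n > 2 * M / \<epsilon>" using reals_Archimedean2 by blast
    moreover from this have "real n > 0" using M(1) \<epsilon>(1) by (smt (verit) divide_pos_pos)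
    ultimately show ?thesis using that by simp
  qed
  define pt where "pt x k = x0 + (real k / real n) *\<^sub>R (x - x0)" for x k
  have pt_K: "pt x k \<in> K" if "x \<in> K" "k \<le> n" for x k
  proof -
    have "pt x k = (1 - real k / real n) *\<^sub>R x0 + (real k / real n) *\<^sub>R x"
      by (simp add: pt_def algebra_simps)
    then show ?thesis
      using convexD[OF assms(1) x0 that(1), of "1 - real k / real n" "real k / real n"] that n by simp
  qed
  have f_X: "f (pt x k) \<in> X" if "x \<in> K" "k \<le> n" for x k
    using pt_K[OF that] assms(4) by auto
  have step: "dist (pt x k) (pt x (Suc k)) < \<epsilon> / 2" if "x \<in> K" for x k
  proof -
    have "pt x (Suc k) - pt x k = (1 / real n) *\<^sub>R (x - x0)"
      by (simp add: pt_def scaleR_diff_left[symmetric] diff_divide_distrib[symmetric])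
    then have "dist (pt x k) (pt x (Suc k)) = norm (x - x0) / real n"
      by (simp add: dist_norm norm_minus_commute[of "pt x k"])
    also have "\<dots> \<le> M / real n"
      using M(2)[OF that] by (simp add: divide_right_mono)
    also have "\<dots> < \<epsilon> / 2"
      using n \<epsilon>(1) by (simp add: field_simps)
    finally show ?thesis .
  qed
  have across: "dist (pt x k) (pt y k) < \<epsilon> / 2" if "dist x y < \<epsilon> / 2" "k \<le> n" for x y k
  proof -
    have "pt x k - pt y k = (real k / real n) *\<^sub>R (x - y)"
      by (simp add: pt_def algebra_simps)
    then have "dist (pt x k) (pt y k) = (real k / real n) * dist x y"
      by (simp add: dist_norm)
    also have "\<dots> \<le> dist x y"
      using that n by (intro mult_left_le_one_le) auto
    finally show ?thesis using that by simp
  qed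
  define \<Phi> where "\<Phi> x = rec_nat \<one> (\<lambda>k g. T (f (pt x k)) (f (pt x (Suc k))) \<otimes> g)" for x
  have \<Phi>_0: "\<Phi> x 0 = \<one>" and \<Phi>_Suc: "\<Phi> x (Suc k) = T (f (pt x k)) (f (pt x (Suc k))) \<otimes> \<Phi> x k" for x k
    by (simp_all add: \<Phi>_def)
  have close: "dist (f u) (f w) < \<delta>" if "u \<in> K" "v \<in> K" "w \<in> K" "dist u v < \<epsilon> / 2" "dist v w < \<epsilon> / 2" for u v w
    using \<epsilon>(2)[OF that(1,3)] dist_triangle[of u w v] that(4,5) by simp
  have \<Phi>_closed: "\<Phi> x k \<in> carrier G" if "x \<in> K" "k \<le> n" for x k
    using that(2)
  proof (induction k)
    case (Suc k)
    have "dist (f (pt x k)) (f (pt x (Suc k))) < \<delta>"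
      using close[of "pt x k" "pt x k" "pt x (Suc k)"] step[OF that(1)] pt_K[OF that(1)] Suc.prems \<epsilon>(1) by simp
    then show ?case
      using Suc f_X[OF that(1)] T_closed by (simp add: \<Phi>_Suc)
  qed (simp add: \<Phi>_0)
  have main: "\<Phi> y k = T (f (pt x k)) (f (pt y k)) \<otimes> \<Phi> x k"
    if xy: "x \<in> K" "y \<in> K" "dist x y < \<epsilon> / 2" and "k \<le> n" for x y k
    using \<open>k \<le> n\<close>
  proof (induction k)
    case 0
    then show ?case
      using T_refl x0 assms(4) by (simp add: \<Phi>_0 pt_def image_subset_iff)
  next
    case (Suc k)
    let ?x = "f (pt x k)" and ?y = "f (pt y k)" and ?x' = "f (pt x (Suc k))" and ?y' = "f (pt y (Suc k))"
    have mem: "?x \<in> X" "?y \<in> X" "?x' \<in> X" "?y' \<in> X"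
      using f_X xy Suc.prems by auto
    note K = pt_K[OF xy(1)] pt_K[OF xy(2)]
    have le: "k \<le> n" using Suc.prems by simp
    have d: "dist ?x ?y < \<delta>" "dist ?y ?y' < \<delta>" "dist ?x ?x' < \<delta>" "dist ?x' ?y' < \<delta>"
      using \<epsilon>(1) K Suc.prems le step[OF xy(1), of k] step[OF xy(2), of k] across[OF xy(3) le] across[OF xy(3) Suc.prems]
        close[of "pt x k" "pt x k" "pt y k"] close[of "pt y k" "pt y k" "pt y (Suc k)"]
        close[of "pt x k" "pt x k" "pt x (Suc k)"] close[of "pt x (Suc k)" "pt x (Suc k)" "pt y (Suc k)"]
      by auto
    have d': "dist ?x ?y' < \<delta>"
      using close[of "pt x k" "pt y k" "pt y (Suc k)"] K Suc.prems le across[OF xy(3) le] step[OF xy(2), of k] by auto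
    note cl = T_closed[OF mem(1,2) d(1)] T_closed[OF mem(2,4) d(2)] T_closed[OF mem(1,3) d(3)]
      T_closed[OF mem(3,4) d(4)] \<Phi>_closed[OF xy(1) le]
    have "\<Phi> y (Suc k) = T ?y ?y' \<otimes> (T ?x ?y \<otimes> \<Phi> x k)"
      using Suc le by (simp add: \<Phi>_Suc)
    \<comment> \<open>Both ways around the small quadrilateral, through \<open>?y\<close> and
      through \<open>?x'\<close>, equal the transition along its diagonal.\<close>
    also have "\<dots> = T ?x ?y' \<otimes> \<Phi> x k"
      using cl T_trans[OF mem(1,2,4) d(1,2) d'] by (simp add: m_assoc)
    also have "\<dots> = T ?x' ?y' \<otimes> \<Phi> x (Suc k)"
      using cl T_trans[OF mem(1,3,4) d(3,4) d'] by (simp add: m_assoc \<Phi>_Suc)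
    finally show ?case .
  qed
  have pt_n: "pt x n = x" for x
    using n by (simp add: pt_def)
  have "parallel K f (\<lambda>x. \<Phi> x n)"
  proof (rule parallelI[of "\<epsilon> / 2"])
    fix x y assume "x \<in> K" "y \<in> K" "dist x y < \<epsilon> / 2"
    then show "\<Phi> y n = T (f x) (f y) \<otimes> \<Phi> x n"
      using main[of x y n] by (simp add: pt_n)
  qed (use \<Phi>_closed \<epsilon> in auto)
  then show ?thesis by blast
qed

text \<open>A chain of short steps from \<open>x0\<close> to \<open>x\<close> stays in the convex
  set, and each step multiplies both sections by the same transition.\<close>

lemma parallel_unique:
  fixes K :: "'k::real_normed_vector set"
  assumes "convex K" and "parallel K f \<phi>" and "parallel K f \<psi>"
    and "x0 \<in> K" and "\<phi> x0 = \<psi> x0" and "x \<in> K"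
  shows "\<phi> x = \<psi> x"
proof -
  obtain \<epsilon> where \<epsilon>: "\<epsilon> > 0" "\<And>x y. \<lbrakk>x \<in> K; y \<in> K; dist x y < \<epsilon>\<rbrakk> \<Longrightarrow> \<phi> y = T (f x) (f y) \<otimes> \<phi> x"
    by (rule parallelE[OF assms(2)]) (rule that)
  obtain \<epsilon>' where \<epsilon>': "\<epsilon>' > 0" "\<And>x y. \<lbrakk>x \<in> K; y \<in> K; dist x y < \<epsilon>'\<rbrakk> \<Longrightarrow> \<psi> y = T (f x) (f y) \<otimes> \<psi> x"
    by (rule parallelE[OF assms(3)]) (rule that)
  define e where "e = min \<epsilon> \<epsilon>'"
  have e: "e > 0" using \<epsilon> \<epsilon>' by (simp add: e_def)
  obtain n :: nat where n: "real n > dist x0 x / e" "n > 0"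
  proof -
    obtain n :: nat where "real n > dist x0 x / e" using reals_Archimedean2 by blast
    moreover from this have "real n > 0" using e by (smt (verit) divide_nonneg_pos zero_le_dist)
    ultimately show ?thesis using that by simp
  qed
  define pt where "pt k = x0 + (real k / real n) *\<^sub>R (x - x0)" for k
  have pt_K: "pt k \<in> K" if "k \<le> n" for k
  proof -
    have "pt k = (1 - real k / real n) *\<^sub>R x0 + (real k / real n) *\<^sub>R x"
      by (simp add: pt_def algebra_simps)
    then show ?thesis
      using convexD[OF assms(1,4,6), of "1 - real k / real n" "real k / real n"] that n by simp
  qed
  have step: "dist (pt k) (pt (Suc k)) < e" for k
  proof -
    have "pt (Suc k) - pt k = (1 / real n) *\<^sub>R (x - x0)"
      by (simp add: pt_def scaleR_diff_left[symmetric] diff_divide_distrib[symmetric])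
    then have "dist (pt k) (pt (Suc k)) = dist x0 x / real n"
      by (simp add: dist_norm norm_minus_commute[of "pt k"] norm_minus_commute[of x0])
    moreover have "dist x0 x < e * real n"
      using n e by (simp add: pos_divide_less_eq mult.commute)
    ultimately show ?thesis
      using n by (simp add: pos_divide_less_eq)
  qed
  have "\<phi> (pt k) = \<psi> (pt k)" if "k \<le> n" for k
    using that
  proof (induction k)
    case 0
    then show ?case using assms(5) by (simp add: pt_def)
  next
    case (Suc k)
    then show ?case
      using \<epsilon>(2)[of "pt k" "pt (Suc k)"] \<epsilon>'(2)[of "pt k" "pt (Suc k)"] pt_K step[of k]
      by (simp add: e_def)
  qed
  from this[of n] show ?thesis using n by (simp add: pt_def)
qed

text \<open>For a path in \<open>X\<close> the description is unique: two sections differ by a right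
  translation, which cancels in the quotient of end value by start value.\<close>

definition holonomy :: "(real \<Rightarrow> 'p) \<Rightarrow> 'a" where
  "holonomy p = (THE g. \<exists>\<phi>. parallel {0..1} p \<phi> \<and> g = \<phi> 1 \<otimes> inv (\<phi> 0))"

lemma holonomy_eq:
  assumes "path_image p \<subseteq> X" and \<phi>: "parallel {0..1} p \<phi>"
  shows "holonomy p = \<phi> 1 \<otimes> inv (\<phi> 0)"
  unfolding holonomy_def
proof (rule the_equality)
  fix g assume "\<exists>\<psi>. parallel {0..1} p \<psi> \<and> g = \<psi> 1 \<otimes> inv (\<psi> 0)"
  then obtain \<psi> where \<psi>: "parallel {0..1} p \<psi>" "g = \<psi> 1 \<otimes> inv (\<psi> 0)" by blast
  have cl: "\<phi> 0 \<in> carrier G" "\<phi> 1 \<in> carrier G" "\<psi> 0 \<in> carrier G" "\<psi> 1 \<in> carrier G"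
    using parallel_closed[OF \<phi>] parallel_closed[OF \<psi>(1)] by auto
  \<comment> \<open>The right factor makes the two sections agree at 0.\<close>
  have "parallel {0..1} p (\<lambda>t. \<psi> t \<otimes> (inv (\<psi> 0) \<otimes> \<phi> 0))"
    using parallel_mult_right[OF \<psi>(1)] assms(1) cl by (simp add: path_image_def)
  from parallel_unique[OF _ \<phi> this, of 0 1]
  have "\<phi> 1 = \<psi> 1 \<otimes> (inv (\<psi> 0) \<otimes> \<phi> 0)"
    using cl by (simp add: m_assoc[symmetric])
  then show "g = \<phi> 1 \<otimes> inv (\<phi> 0)"
    using cl \<psi>(2) by (simp add: m_assoc)
qed (use \<phi> in blast)

lemma path_parallel:
  assumes "path p" and "path_image p \<subseteq> X"
  obtains \<phi> where "parallel {0..1} p \<phi>"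
  using parallel_exists[of "{0..1}" p] assms by (auto simp: path_def path_image_def)

lemma holonomy_closed:
  assumes "path p" and "path_image p \<subseteq> X"
  shows "holonomy p \<in> carrier G"
  using assms by (metis path_parallel holonomy_eq parallel_closed atLeastAtMost_iff inv_closed
      m_closed order_refl zero_le_one)

text \<open>One section along the concatenation restricts to both halves, with a common value at
  1/2. The later path stands on the left, as in \<open>trail_value\<close> and in the cocycle
  identity.\<close>

lemma holonomy_join:
  assumes "path p" and "path q" and "pathfinish p = pathstart q"
    and "path_image p \<subseteq> X" and "path_image q \<subseteq> X"
  shows "holonomy (p +++ q) = holonomy q \<otimes> holonomy p"
proof -
  have im: "path_image (p +++ q) \<subseteq> X"
    using assms by (simp add: path_image_join)
  obtain \<phi> where \<phi>: "parallel {0..1} (p +++ q) \<phi>"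
    using path_parallel[OF _ im] assms by auto
  have uc: "uniformly_continuous_on {0..1} (\<lambda>t::real. t / 2)"
    "uniformly_continuous_on {0..1} (\<lambda>t::real. (1 + t) / 2)"
    by (auto intro!: compact_uniformly_continuous continuous_intros)
  have "parallel {0..1} p (\<phi> \<circ> (\<lambda>t. t / 2))"
    by (rule parallel_cong[OF parallel_compose[OF \<phi> uc(1)]]) (auto simp: joinpaths_def)
  then have 1: "holonomy p = \<phi> (1/2) \<otimes> inv (\<phi> 0)"
    using holonomy_eq[OF assms(4)] by fastforce
  have "parallel {0..1} q (\<phi> \<circ> (\<lambda>t. (1 + t) / 2))"
    using assms(3)
    by (intro parallel_cong[OF parallel_compose[OF \<phi> uc(2)]])
       (auto simp: joinpaths_def pathfinish_def pathstart_def add_divide_distrib)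
  then have 2: "holonomy q = \<phi> 1 \<otimes> inv (\<phi> (1/2))"
    using holonomy_eq[OF assms(5)] by fastforce
  have "\<phi> 0 \<in> carrier G" "\<phi> 1 \<in> carrier G" "\<phi> (1/2) \<in> carrier G"
    using parallel_closed[OF \<phi>] by auto
  then show ?thesis
    using 1 2 holonomy_eq[OF im \<phi>] by (metis inv_closed m_assoc m_closed l_inv l_one)
qed

lemma holonomy_reversepath:
  assumes "path p" and "path_image p \<subseteq> X"
  shows "holonomy (reversepath p) = inv (holonomy p)"
proof -
  obtain \<phi> where \<phi>: "parallel {0..1} p \<phi>"
    using path_parallel assms by blast
  have "uniformly_continuous_on {0..1} (\<lambda>t::real. 1 - t)"
    by (auto intro!: compact_uniformly_continuous continuous_intros)
  then have "parallel {0..1} (reversepath p) (\<phi> \<circ> (\<lambda>t. 1 - t))"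
    by (intro parallel_cong[OF parallel_compose[OF \<phi>]]) (auto simp: reversepath_def)
  then have "holonomy (reversepath p) = \<phi> 0 \<otimes> inv (\<phi> 1)"
    using holonomy_eq[of "reversepath p"] assms by fastforce
  then show ?thesis
    using holonomy_eq[OF assms(2) \<phi>] parallel_closed[OF \<phi>] by (simp add: inv_mult_group)
qed

text \<open>Over a constant map every transition is \<open>T p p\<close>, the unit, so constants are
  sections and uniqueness leaves no others.\<close>

lemma parallel_const:
  fixes K :: "'k::real_normed_vector set"
  assumes "convex K" and "parallel K f \<phi>" and "\<And>x. x \<in> K \<Longrightarrow> f x = p"
    and "p \<in> X" and "x \<in> K" and "y \<in> K"
  shows "\<phi> x = \<phi> y"
proof -
  have cl: "\<phi> x \<in> carrier G"
    using assms parallel_closed by blast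
  have "parallel K f (\<lambda>_. \<phi> x)"
    using assms(3) cl T_refl[OF assms(4)] delta_pos by (intro parallelI[of 1]) auto
  from parallel_unique[OF assms(1,2) this assms(5) _ assms(6)] show ?thesis by simp
qed

text \<open>A single section over the whole square restricts to sections along \<open>p\<close> and
  \<open>q\<close>. On the two sides where the homotopy fixes an end point it is constant, so
  \<open>p\<close> and \<open>q\<close> see the same start and end values.\<close>

lemma holonomy_homotopic:
  assumes "homotopic_paths X p q"
  shows "holonomy p = holonomy q"
proof -
  obtain h where h: "continuous_on ({0..1} \<times> {0..1}) h" "h ` ({0..1} \<times> {0..1}) \<subseteq> X"
    and ends: "\<forall>x\<in>{0..1}. h (0, x) = p x" "\<forall>x\<in>{0..1}. h (1, x) = q x"
      "\<forall>t\<in>{0..1::real}. pathstart (h \<circ> Pair t) = pathstart p \<and> pathfinish (h \<circ> Pair t) = pathfinish p"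
    using assms unfolding homotopic_paths by blast
  obtain \<Phi> where \<Phi>: "parallel ({0..1} \<times> {0..1}) h \<Phi>"
    using parallel_exists[OF _ _ h] by (auto intro: convex_Times compact_Times)
  have im: "path_image p \<subseteq> X" "path_image q \<subseteq> X"
    using homotopic_paths_imp_subset[OF assms] by auto
  have h0: "h (t, 0) = pathstart p" and h1: "h (t, 1) = pathfinish p" if "t \<in> {0..1}" for t
    using ends(3) that by (auto simp: pathstart_def pathfinish_def)
  have in_X: "pathstart p \<in> X" "pathfinish p \<in> X"
    using im by auto
  have uc: "uniformly_continuous_on {0..1} (\<lambda>t::real. (t, c))"
    "uniformly_continuous_on {0..1} (\<lambda>t::real. (c, t))" for c :: real
    by (auto intro!: compact_uniformly_continuous continuous_intros)
  have side: "parallel {0..1} (h \<circ> (\<lambda>t. (t, c))) (\<Phi> \<circ> (\<lambda>t. (t, c)))"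
    "parallel {0..1} (h \<circ> (\<lambda>t. (c, t))) (\<Phi> \<circ> (\<lambda>t. (c, t)))" if "c \<in> {0..1}" for c
    using that by (auto intro!: parallel_compose[OF \<Phi>] uc)
  have "(\<Phi> \<circ> (\<lambda>t. (t, 0))) 0 = (\<Phi> \<circ> (\<lambda>t. (t, 0))) 1"
    by (rule parallel_const[OF _ side(1)[of 0] _ in_X(1)]) (auto simp: h0)
  moreover have "(\<Phi> \<circ> (\<lambda>t. (t, 1))) 0 = (\<Phi> \<circ> (\<lambda>t. (t, 1))) 1"
    by (rule parallel_const[OF _ side(1)[of 1] _ in_X(2)]) (auto simp: h1)
  moreover have "holonomy p = (\<Phi> \<circ> (\<lambda>t. (0, t))) 1 \<otimes> inv ((\<Phi> \<circ> (\<lambda>t. (0, t))) 0)"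
    using side(2)[of 0] ends(1) by (intro holonomy_eq[OF im(1)] parallel_cong[OF side(2)]) auto
  moreover have "holonomy q = (\<Phi> \<circ> (\<lambda>t. (1, t))) 1 \<otimes> inv ((\<Phi> \<circ> (\<lambda>t. (1, t))) 0)"
    using side(2)[of 1] ends(2) by (intro holonomy_eq[OF im(2)] parallel_cong[OF side(2)]) auto
  ultimately show ?thesis by simp
qed

text \<open>The composite of \<open>F\<close> with \<open>p\<close> is itself a section, even for
  discontinuous \<open>F\<close>. It is applied to the transitions from a fixed point on short paths
  and to the potential of a trivial cocycle.\<close>

lemma holonomy_potential:
  assumes p: "path p" "path_image p \<subseteq> X"
    and F: "\<And>x. x \<in> path_image p \<Longrightarrow> F x \<in> carrier G"
    and T: "\<And>x y. \<lbrakk>x \<in> path_image p; y \<in> path_image p; dist x y < \<delta>\<rbrakk> \<Longrightarrow> F y = T x y \<otimes> F x"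
  shows "holonomy p = F (pathfinish p) \<otimes> inv (F (pathstart p))"
proof -
  have "uniformly_continuous_on {0..1} p"
    using p by (auto intro: compact_uniformly_continuous simp: path_def)
  then obtain \<epsilon> where "\<epsilon> > 0" "\<And>s t. \<lbrakk>s \<in> {0..1}; t \<in> {0..1}; dist s t < \<epsilon>\<rbrakk> \<Longrightarrow> dist (p s) (p t) < \<delta>"
    using delta_pos unfolding uniformly_continuous_on_def by (metis dist_commute)
  then have "parallel {0..1} p (F \<circ> p)"
    using F by (intro parallelI[of \<epsilon>]) (auto simp: path_image_def intro!: T)
  from holonomy_eq[OF p(2) this] show ?thesis
    by (simp add: pathstart_def pathfinish_def)
qed

lemma holonomy_close:
  assumes p: "path p" "path_image p \<subseteq> X"
    and close: "\<And>x y. \<lbrakk>x \<in> path_image p; y \<in> path_image p\<rbrakk> \<Longrightarrow> dist x y < \<delta>"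
  shows "holonomy p = T (pathstart p) (pathfinish p)"
proof -
  let ?s = "pathstart p"
  have s: "?s \<in> path_image p" by (rule pathstart_in_path_image)
  have "holonomy p = T ?s (pathfinish p) \<otimes> inv (T ?s ?s)"
    using p close s by (intro holonomy_potential[where F = "T ?s"] T_closed T_trans) auto
  moreover have "?s \<in> X" "pathfinish p \<in> X"
    using p by auto
  ultimately show ?thesis
    using T_refl[of ?s] T_closed[of ?s "pathfinish p"] close[OF s pathfinish_in_path_image] by simp
qed

end

text \<open>By commutativity the pointwise product of two sections is a section for the product of
  the transition functions. Three instances of the locale are compared, hence the place outside
  it.\<close>

lemma holonomy_mult:
  assumes "comm_group G" and T: "local_transition G X \<delta> T" and T': "local_transition G X \<delta> T'"
    and U: "local_transition G X \<delta> U"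
    and eq: "\<And>x y. \<lbrakk>x \<in> X; y \<in> X; dist x y < \<delta>\<rbrakk> \<Longrightarrow> U x y = T x y \<otimes>\<^bsub>G\<^esub> T' x y"
    and p: "path p" "path_image p \<subseteq> X"
  shows "local_transition.holonomy G \<delta> U p =
    local_transition.holonomy G \<delta> T p \<otimes>\<^bsub>G\<^esub> local_transition.holonomy G \<delta> T' p"
proof -
  interpret comm_group G by fact
  interpret T: local_transition G X \<delta> T by fact
  interpret T': local_transition G X \<delta> T' by fact
  interpret U: local_transition G X \<delta> U by fact
  obtain \<phi> where \<phi>: "T.parallel {0..1} p \<phi>" using T.path_parallel p by blast
  obtain \<psi> where \<psi>: "T'.parallel {0..1} p \<psi>" using T'.path_parallel p by blast
  have cl: "\<phi> t \<in> carrier G" "\<psi> t \<in> carrier G" if "t \<in> {0..1}" for t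
    using T.parallel_closed[OF \<phi>] T'.parallel_closed[OF \<psi>] that by auto
  obtain \<epsilon> where \<epsilon>: "\<epsilon> > 0" "\<And>x y. \<lbrakk>x \<in> {0..1}; y \<in> {0..1}; dist x y < \<epsilon>\<rbrakk> \<Longrightarrow> dist (p x) (p y) < \<delta>"
    "\<And>x y. \<lbrakk>x \<in> {0..1}; y \<in> {0..1}; dist x y < \<epsilon>\<rbrakk> \<Longrightarrow> \<phi> y = T (p x) (p y) \<otimes>\<^bsub>G\<^esub> \<phi> x"
    by (rule T.parallelE[OF \<phi>]) (rule that)
  obtain \<epsilon>' where \<epsilon>': "\<epsilon>' > 0" "\<And>x y. \<lbrakk>x \<in> {0..1}; y \<in> {0..1}; dist x y < \<epsilon>'\<rbrakk> \<Longrightarrow>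
      \<psi> y = T' (p x) (p y) \<otimes>\<^bsub>G\<^esub> \<psi> x"
    by (rule T'.parallelE[OF \<psi>]) (rule that)
  have "U.parallel {0..1} p (\<lambda>t. \<phi> t \<otimes>\<^bsub>G\<^esub> \<psi> t)"
  proof (rule U.parallelI[of "min \<epsilon> \<epsilon>'"])
    fix x y :: real assume xy: "x \<in> {0..1}" "y \<in> {0..1}" "dist x y < min \<epsilon> \<epsilon>'"
    then have X: "p x \<in> X" "p y \<in> X" and d: "dist x y < \<epsilon>" "dist x y < \<epsilon>'"
      using p by (auto simp: path_image_def)
    note near = \<epsilon>(2)[OF xy(1,2) d(1)]
    show "dist (p x) (p y) < \<delta>" by (rule near)
    show "\<phi> y \<otimes>\<^bsub>G\<^esub> \<psi> y = U (p x) (p y) \<otimes>\<^bsub>G\<^esub> (\<phi> x \<otimes>\<^bsub>G\<^esub> \<psi> x)"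
      unfolding \<epsilon>(3)[OF xy(1,2) d(1)] \<epsilon>'(2)[OF xy(1,2) d(2)] eq[OF X near]
      using cl[OF xy(1)] T.T_closed[OF X near] T'.T_closed[OF X near] by (simp add: m_ac)
  qed (use cl \<epsilon>(1) \<epsilon>'(1) in auto)
  from U.holonomy_eq[OF p(2) this] T.holonomy_eq[OF p(2) \<phi>] T'.holonomy_eq[OF p(2) \<psi>] cl[of 0] cl[of 1]
  show ?thesis by (simp add: inv_mult m_ac)
qed

section \<open>Cube complexes and trails\<close>

lemma mem_cube:
  "x \<in> cbox (lattice_point z) (lattice_point (z + 1)) \<longleftrightarrow> (\<forall>i. of_int (z $ i) \<le> x $ i \<and> x $ i \<le> of_int (z $ i) + 1)"
  by (simp add: mem_box_cart lattice_point_def)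

lemma cube_complexI:
  assumes "cube_corners z \<subseteq> S" and "x \<in> cbox (lattice_point z) (lattice_point (z + 1))"
  shows "x \<in> cube_complex S"
  using assms unfolding cube_complex_def by blast

lemma cube_complexE:
  assumes "x \<in> cube_complex S"
  obtains z where "cube_corners z \<subseteq> S" and "x \<in> cbox (lattice_point z) (lattice_point (z + 1))"
  using assms unfolding cube_complex_def by blast

lemma corner_in_cube: "w \<in> cube_corners z \<Longrightarrow> lattice_point w \<in> cbox (lattice_point z) (lattice_point (z + 1))"
  unfolding mem_cube cube_corners_def mem_Collect_eq
proof
  fix i assume "\<forall>i. w $ i = z $ i \<or> w $ i = z $ i + 1"
  then have "w $ i = z $ i \<or> w $ i = z $ i + 1" ..
  then show "real_of_int (z $ i) \<le> lattice_point w $ i \<and> lattice_point w $ i \<le> real_of_int (z $ i) + 1"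
    by (auto simp: lattice_point_def)
qed

lemma cube_complex_mono: "S \<subseteq> S' \<Longrightarrow> cube_complex S \<subseteq> cube_complex S'"
  unfolding cube_complex_def by blast

section \<open>Rounding to the lattice and open stars of vertices\<close>

definition nearest :: "real ^ 'd \<Rightarrow> int ^ 'd" where
  "nearest x = (\<chi> i. round (x $ i))"

lemma nearest_lattice_point [simp]: "nearest (lattice_point z) = z"
  by (simp add: nearest_def lattice_point_def vec_eq_iff)

lemma nearest_dist: "\<bar>x $ i - of_int (nearest x $ i)\<bar> \<le> 1 / 2"
  using of_int_round_abs_le[of "x $ i"] by (simp add: nearest_def abs_minus_commute)

lemma abs_component_diff_le: "\<bar>x $ i - y $ i\<bar> \<le> dist x (y :: real ^ 'd::finite)"
  using component_le_norm_cart[of "x - y" i] by (simp add: dist_norm)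

text \<open>The integers strictly between \<open>z $ i - 1\<close> and \<open>z $ i + 2\<close> are
  \<open>z $ i\<close> and \<open>z $ i + 1\<close>. The strict bound is what makes \<open>w\<close>
  a corner of every cube that contains \<open>x\<close>.\<close>

lemma near_corner:
  assumes "x \<in> cbox (lattice_point z) (lattice_point (z + 1))" and "\<And>i. \<bar>x $ i - of_int (w $ i)\<bar> < 1"
  shows "w \<in> cube_corners z"
  unfolding cube_corners_def
proof clarify
  fix i assume "w $ i \<noteq> z $ i + 1"
  have "real_of_int (w $ i) < of_int (z $ i + 2)" "real_of_int (z $ i - 1) < of_int (w $ i)"
    using assms(1)[unfolded mem_cube, rule_format, of i] assms(2)[of i] by auto
  then have "w $ i < z $ i + 2" "z $ i - 1 < w $ i" unfolding of_int_less_iff by auto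
  with \<open>w $ i \<noteq> z $ i + 1\<close> show "w $ i = z $ i" by simp
qed

lemma nearest_corner:
  assumes "x \<in> cbox (lattice_point z) (lattice_point (z + 1))"
  shows "nearest x \<in> cube_corners z"
  by (rule near_corner[OF assms], rule order_le_less_trans[OF nearest_dist]) simp

lemma nearest_in: "x \<in> cube_complex S \<Longrightarrow> nearest x \<in> S"
  by (meson cube_complexE nearest_corner subsetD)

text \<open>The open star of the vertex \<open>w\<close>. It is empty unless \<open>w\<close>
  belongs to \<open>S\<close>, since \<open>w\<close> is a corner of every cube that contains a
  point of it.\<close>

definition star :: "(int ^ 'd) set \<Rightarrow> int ^ 'd \<Rightarrow> (real ^ 'd::finite) set" where
  "star S w = {x \<in> cube_complex S. \<forall>i. \<bar>x $ i - of_int (w $ i)\<bar> < 1}"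

text \<open>The cube that puts \<open>x\<close> into the complex has \<open>w\<close> as a corner
  and is convex; along the segment the coordinate distances to \<open>w\<close> shrink by the factor
  \<open>u\<close>.\<close>

lemma star_segment:
  assumes x: "x \<in> star S w"
  shows "closed_segment (lattice_point w) x \<subseteq> star S w"
proof
  fix y assume y: "y \<in> closed_segment (lattice_point w) x"
  obtain z where z: "cube_corners z \<subseteq> S" "x \<in> cbox (lattice_point z) (lattice_point (z + 1))"
    using x cube_complexE unfolding star_def by blast
  have "w \<in> cube_corners z"
    using near_corner[OF z(2)] x unfolding star_def by blast
  then have "closed_segment (lattice_point w) x \<subseteq> cbox (lattice_point z) (lattice_point (z + 1))"
    by (simp add: closed_segment_subset corner_in_cube z(2))
  moreover have "\<bar>y $ i - of_int (w $ i)\<bar> < 1" for i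
  proof -
    obtain u where u: "0 \<le> u" "u \<le> 1" "y = (1 - u) *\<^sub>R lattice_point w + u *\<^sub>R x"
      using y by (auto simp: in_segment)
    have "y $ i - of_int (w $ i) = u * (x $ i - of_int (w $ i))"
      by (simp add: u(3) lattice_point_def algebra_simps)
    then have "\<bar>y $ i - of_int (w $ i)\<bar> \<le> \<bar>x $ i - of_int (w $ i)\<bar>"
      using u(1,2) by (simp add: abs_mult mult_left_le_one_le)
    moreover have "\<bar>x $ i - of_int (w $ i)\<bar> < 1"
      using x by (simp add: star_def)
    ultimately show ?thesis by linarith
  qed
  ultimately show "y \<in> star S w"
    using cube_complexI[OF z(1)] y unfolding star_def by blast
qed

lemma star_simply_connected: "simply_connected (star S w)"
proof (cases "star S w = {}")
  case False
  then have "lattice_point w \<in> star S w"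
    using star_segment by fastforce
  then have "starlike (star S w)"
    unfolding starlike_def using star_segment by blast
  then show ?thesis by (rule starlike_imp_simply_connected)
qed simp

section \<open>Polygonal paths of trails\<close>

lemma pathstart_trail_path: "zs \<noteq> [] \<Longrightarrow> pathstart (trail_path zs) = lattice_point (hd zs)"
  by (induction zs rule: trail_path.induct) auto

lemma pathfinish_trail_path: "zs \<noteq> [] \<Longrightarrow> pathfinish (trail_path zs) = lattice_point (last zs)"
  by (induction zs rule: trail_path.induct) auto

lemma path_trail_path: "path (trail_path zs)"
  by (induction zs rule: trail_path.induct) (auto simp: pathstart_trail_path path_def[of "\<lambda>_. _"])

text \<open>Adjacent sites of \<open>S\<close> need not be corners of a common cube of the complex,
  so a trail in \<open>S\<close> may have edges outside \<open>cube_complex S\<close>. Containment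
  has to come from a convex cube, as here, or from membership in a homotopy class.\<close>

lemma path_image_trail_path:
  assumes "zs \<noteq> []" and "lattice_point ` set zs \<subseteq> K" and "convex K"
  shows "path_image (trail_path zs) \<subseteq> K"
  using assms
proof (induction zs rule: trail_path.induct)
  case (3 y z zs)
  then show ?case
    by (simp add: path_image_join pathstart_trail_path closed_segment_subset)
qed auto

lemma trail_in_single [simp]: "trail_in S [z] \<longleftrightarrow> z \<in> S"
  by (simp add: trail_in_def)

lemma trail_in_Cons: "trail_in S (y # z # zs) \<longleftrightarrow> y \<in> S \<and> z - y \<in> unit_steps \<and> trail_in S (z # zs)"
  unfolding trail_in_def by (force simp: nth_Cons split: nat.splits)

lemma trail_in_mono: "trail_in S zs \<Longrightarrow> S \<subseteq> S' \<Longrightarrow> trail_in S' zs"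
  unfolding trail_in_def by blast

lemma trail_in_append:
  assumes "trail_in S zs" and "trail_in S ws" and "last zs = hd ws"
  shows "trail_in S (zs @ tl ws)"
  using assms
proof (induction zs rule: trail_path.induct)
  case (2 z)
  then show ?case by (cases ws) (auto simp: trail_in_def)
qed (auto simp: trail_in_Cons trail_in_def[of S "[]"])

text \<open>\<open>tl\<close> drops the site where the trails meet. A one-site trail gives a
  constant path, absorbed by the unit law; the inductive step reassociates.\<close>

lemma homotopic_trail_path_append:
  assumes "zs \<noteq> []" and "ws \<noteq> []" and "last zs = hd ws"
    and "path_image (trail_path zs) \<subseteq> X" and "path_image (trail_path ws) \<subseteq> X"
  shows "homotopic_paths X (trail_path zs +++ trail_path ws) (trail_path (zs @ tl ws))"
  using assms
proof (induction zs rule: trail_path.induct)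
  case (2 z)
  then have "homotopic_paths X (linepath (lattice_point z) (lattice_point z) +++ trail_path ws) (trail_path ws)"
    by (intro homotopic_paths_lid') (auto simp: path_trail_path pathstart_trail_path)
  moreover have "[z] @ tl ws = ws"
    using 2 by (cases ws) auto
  ultimately show ?case
    by (simp only: trail_path.simps(2))
next
  case (3 y z zs)
  let ?e = "linepath (lattice_point y) (lattice_point z)"
  have im: "path_image ?e \<subseteq> X" "path_image (trail_path (z # zs)) \<subseteq> X"
    using 3(5) by (auto simp: path_image_join pathstart_trail_path)
  have "homotopic_paths X (trail_path (y # z # zs) +++ trail_path ws)
      (?e +++ (trail_path (z # zs) +++ trail_path ws))"
    unfolding trail_path.simps(3)
    using im 3(3,4,6)
    by (intro homotopic_paths_sym[OF homotopic_paths_assoc])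
       (auto simp: path_trail_path pathstart_trail_path pathfinish_trail_path)
  also have "homotopic_paths X \<dots> (?e +++ trail_path ((z # zs) @ tl ws))"
    using im 3
    by (intro homotopic_paths_join 3(1)) (auto simp: pathstart_trail_path)
  finally show ?case by simp
qed simp

text \<open>Change the coordinates in which \<open>w\<close> and \<open>w'\<close> differ one at a
  time: each change is a unit step and leads to a corner again.\<close>

lemma corner_trail:
  assumes "w \<in> cube_corners z" and "w' \<in> cube_corners z"
  obtains zs where "trail_in (cube_corners z) zs" and "hd zs = w" and "last zs = w'"
proof -
  have "\<exists>zs. trail_in (cube_corners z) zs \<and> hd zs = w \<and> last zs = w'"
    using assms(1)
  proof (induction "card {i. w $ i \<noteq> w' $ i}" arbitrary: w rule: less_induct)
    case less
    show ?case
    proof (cases "w = w'")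
      case True
      then show ?thesis using less.prems by (intro exI[of _ "[w]"]) simp
    next
      case False
      then obtain i where i: "w $ i \<noteq> w' $ i" by (auto simp: vec_eq_iff)
      define v where "v = (\<chi> j. if j = i then w' $ i else w $ j)"
      have c: "w $ j = z $ j \<or> w $ j = z $ j + 1" "w' $ j = z $ j \<or> w' $ j = z $ j + 1" for j
        using less.prems assms(2) unfolding cube_corners_def by blast+
      have v: "v \<in> cube_corners z"
        using c unfolding v_def cube_corners_def by force
      have "{j. v $ j \<noteq> w' $ j} \<subset> {j. w $ j \<noteq> w' $ j}"
        using i by (auto simp: v_def)
      then have "card {j. v $ j \<noteq> w' $ j} < card {j. w $ j \<noteq> w' $ j}"
        by (intro psubset_card_mono) auto
      then obtain zs where zs: "trail_in (cube_corners z) zs" "hd zs = v" "last zs = w'"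
        using less.hyps[OF _ v] by blast
      have "w' $ i - w $ i = 1 \<or> w' $ i - w $ i = - 1"
        using i c[of i] by (elim disjE) simp_all
      then have "v - w = axis i 1 \<or> v - w = - axis i 1"
        by (elim disjE) (simp_all add: v_def vec_eq_iff axis_def)
      then have "v - w \<in> unit_steps"
        unfolding unit_steps_def by blast
      moreover obtain ws where "zs = v # ws"
        using zs(1,2) by (cases zs) (auto simp: trail_in_def[of _ "[]"])
      ultimately have "trail_in (cube_corners z) (w # zs) \<and> hd (w # zs) = w \<and> last (w # zs) = w'"
        using zs(1,3) less.prems by (simp add: trail_in_Cons)
      then show ?thesis ..
    qed
  qed
  then show thesis using that by blast
qed

section \<open>Deforming paths into trails\<close>

lemma simply_connected_homotopic:
  fixes S :: "'p::real_normed_vector set"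
  assumes "simply_connected S" and "path p" "path_image p \<subseteq> S" and "path q" "path_image q \<subseteq> S"
    and "pathstart p = pathstart q" and "pathfinish p = pathfinish q"
  shows "homotopic_paths S p q"
proof -
  note simply_connected_eq_homotopic_paths[THEN iffD1, OF assms(1), THEN conjunct2, rule_format, of p q]
  then show ?thesis using assms(2-) by simp
qed

lemma homotopic_cancel:
  fixes p :: "real \<Rightarrow> 'p::real_normed_vector"
  assumes "path p" "path_image p \<subseteq> X" and "path q" "path_image q \<subseteq> X" and "path r" "path_image r \<subseteq> X"
    and "pathfinish p = pathstart q" and "pathstart r = pathfinish p"
  shows "homotopic_paths X ((p +++ q) +++ (reversepath q +++ r)) (p +++ r)"
proof -
  have "homotopic_paths X ((p +++ q) +++ (reversepath q +++ r)) (p +++ (q +++ (reversepath q +++ r)))"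
    using assms by (intro homotopic_paths_sym[OF homotopic_paths_assoc]) (auto simp: path_image_join)
  also have "homotopic_paths X \<dots> (p +++ ((q +++ reversepath q) +++ r))"
    using assms by (intro homotopic_paths_join homotopic_paths_assoc) auto
  also have "homotopic_paths X \<dots> (p +++ (linepath (pathstart q) (pathstart q) +++ r))"
    using assms by (intro homotopic_paths_join homotopic_paths_rinv) auto
  also have "homotopic_paths X \<dots> (p +++ r)"
    using assms by (intro homotopic_paths_join homotopic_paths_lid') auto
  finally show ?thesis .
qed

text \<open>The ends of a piece of a path are rarely lattice points, so straight spurs to lattice
  points are added. Fixing these points by \<open>nearest\<close> makes the spurs of adjacent pieces
  inverse to each other.\<close>

definition near_trail :: "(int ^ 'd) set \<Rightarrow> (real \<Rightarrow> real ^ 'd::finite) \<Rightarrow> (int ^ 'd) list \<Rightarrow> bool" where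
  "near_trail S g zs \<longleftrightarrow> trail_in S zs \<and> hd zs = nearest (pathstart g) \<and> last zs = nearest (pathfinish g) \<and>
     homotopic_paths (cube_complex S) g
       (linepath (pathstart g) (lattice_point (hd zs)) +++
        (trail_path zs +++ linepath (lattice_point (last zs)) (pathfinish g)))"

text \<open>A homotopy inside the complex forces every part of its target into the complex; this
  supplies the containments that the trail alone does not give.\<close>

lemma near_trailD:
  assumes "near_trail S g zs"
  shows "zs \<noteq> []" and "path g" and "path_image g \<subseteq> cube_complex S"
    and "path_image (linepath (pathstart g) (lattice_point (hd zs))) \<subseteq> cube_complex S"
    and "path_image (trail_path zs) \<subseteq> cube_complex S"
    and "path_image (linepath (lattice_point (last zs)) (pathfinish g)) \<subseteq> cube_complex S"
proof -
  have "trail_in S zs"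
    using assms unfolding near_trail_def by (elim conjE)
  then show ne: "zs \<noteq> []"
    unfolding trail_in_def by (elim conjE)
  have h: "homotopic_paths (cube_complex S) g
       (linepath (pathstart g) (lattice_point (hd zs)) +++
        (trail_path zs +++ linepath (lattice_point (last zs)) (pathfinish g)))"
    using assms unfolding near_trail_def by (elim conjE)
  show "path g" and "path_image g \<subseteq> cube_complex S"
    using homotopic_paths_imp_path[OF h] homotopic_paths_imp_subset[OF h] by auto
  have "path_image (linepath (pathstart g) (lattice_point (hd zs)) +++
        (trail_path zs +++ linepath (lattice_point (last zs)) (pathfinish g))) =
      path_image (linepath (pathstart g) (lattice_point (hd zs))) \<union>
        (path_image (trail_path zs) \<union> path_image (linepath (lattice_point (last zs)) (pathfinish g)))"
    using ne by (subst path_image_join; (subst path_image_join)?)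
      (simp_all add: pathstart_trail_path pathfinish_trail_path)
  then show "path_image (linepath (pathstart g) (lattice_point (hd zs))) \<subseteq> cube_complex S"
    "path_image (trail_path zs) \<subseteq> cube_complex S"
    "path_image (linepath (lattice_point (last zs)) (pathfinish g)) \<subseteq> cube_complex S"
    using homotopic_paths_imp_subset[OF h] by (simp_all only: Un_subset_iff)
qed

lemma near_trail_homotopic:
  assumes "near_trail S g zs" and "homotopic_paths (cube_complex S) g h"
  shows "near_trail S h zs"
proof -
  have g: "trail_in S zs" "hd zs = nearest (pathstart g)" "last zs = nearest (pathfinish g)"
    "homotopic_paths (cube_complex S) g
       (linepath (pathstart g) (lattice_point (hd zs)) +++
        (trail_path zs +++ linepath (lattice_point (last zs)) (pathfinish g)))"
    using assms(1) unfolding near_trail_def by blast+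
  have "pathstart h = pathstart g" "pathfinish h = pathfinish g"
    using homotopic_paths_imp_pathstart[OF assms(2)] homotopic_paths_imp_pathfinish[OF assms(2)] by simp_all
  then show ?thesis
    unfolding near_trail_def
    using g(1-3) homotopic_paths_trans[OF homotopic_paths_sym[OF assms(2)] g(4)] by simp
qed

text \<open>At the junction both pieces have the spur between the common end point and its nearest
  site, in opposite directions. Cancelling it makes the trails meet.\<close>

lemma near_trail_join:
  assumes g: "near_trail S g zs" and h: "near_trail S h ws" and eq: "pathfinish g = pathstart h"
  shows "near_trail S (g +++ h) (zs @ tl ws)"
proof -
  let ?X = "cube_complex S"
  let ?A = "linepath (pathstart g) (lattice_point (hd zs))"
  let ?B = "linepath (lattice_point (last zs)) (pathfinish g)"
  let ?C = "linepath (lattice_point (last ws)) (pathfinish h)"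
  note D = near_trailD[OF g] near_trailD[OF h]
  note tp = path_trail_path pathstart_trail_path pathfinish_trail_path
  have mid: "last zs = hd ws"
    using g h eq by (simp add: near_trail_def)
  have rev: "linepath (pathstart h) (lattice_point (hd ws)) = reversepath ?B"
    by (simp add: mid eq)
  have last: "last (zs @ tl ws) = last ws"
    using D(1) D(7) mid by (cases ws) (auto simp: last_append)
  have hd: "hd (zs @ tl ws) = hd zs"
    using D(1) by simp
  have "homotopic_paths ?X (g +++ h)
      ((?A +++ (trail_path zs +++ ?B)) +++ (reversepath ?B +++ (trail_path ws +++ ?C)))"
    using g h eq unfolding near_trail_def rev[symmetric] by (intro homotopic_paths_join) auto
  also have "homotopic_paths ?X \<dots>
      (((?A +++ trail_path zs) +++ ?B) +++ (reversepath ?B +++ (trail_path ws +++ ?C)))"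
    using D mid eq
    by (intro homotopic_paths_join homotopic_paths_assoc) (auto simp: tp path_image_join simp del: reversepath_linepath)
  also have "homotopic_paths ?X \<dots> ((?A +++ trail_path zs) +++ (trail_path ws +++ ?C))"
    using D mid eq by (intro homotopic_cancel) (auto simp: tp path_image_join)
  also have "homotopic_paths ?X \<dots> (?A +++ (trail_path zs +++ (trail_path ws +++ ?C)))"
    using D mid by (intro homotopic_paths_sym[OF homotopic_paths_assoc]) (auto simp: tp path_image_join)
  also have "homotopic_paths ?X \<dots> (?A +++ ((trail_path zs +++ trail_path ws) +++ ?C))"
    using D mid by (intro homotopic_paths_join homotopic_paths_assoc) (auto simp: tp path_image_join)
  also have "homotopic_paths ?X \<dots> (?A +++ (trail_path (zs @ tl ws) +++ ?C))"
    using D mid by (intro homotopic_paths_join homotopic_trail_path_append) (auto simp: tp path_image_join)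
  finally have hom: "homotopic_paths ?X (g +++ h) (?A +++ (trail_path (zs @ tl ws) +++ ?C))" .
  have "trail_in S zs" "trail_in S ws" "hd zs = nearest (pathstart g)" "last ws = nearest (pathfinish h)"
    using g h unfolding near_trail_def by blast+
  with trail_in_append[OF this(1,2) mid] hom show ?thesis
    unfolding near_trail_def hd last pathstart_join pathfinish_join by blast
qed

text \<open>Rounding costs at most 1/2 and the path moves by less than 1/2, so it lies in the star
  of the site nearest to its start. The star is simply connected, and the path can be pulled to two
  segments through \<open>w\<close>.\<close>

lemma near_trail_small:
  assumes "path g" and im: "path_image g \<subseteq> cube_complex S"
    and small: "\<And>x. x \<in> path_image g \<Longrightarrow> dist (pathstart g) x < 1 / 2"
  shows "\<exists>zs. near_trail S g zs"
proof -
  let ?X = "cube_complex S" and ?x = "pathstart g" and ?y = "pathfinish g"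
  define w where "w = nearest ?x"
  define w' where "w' = nearest ?y"
  have U: "path_image g \<subseteq> star S w"
  proof
    fix x assume x: "x \<in> path_image g"
    have "\<bar>x $ i - of_int (w $ i)\<bar> < 1" for i
      using abs_component_diff_le[of ?x i x] small[OF x] nearest_dist[of ?x i] unfolding w_def by linarith
    then show "x \<in> star S w" using im x by (auto simp: star_def)
  qed
  then have Ux: "?x \<in> star S w" and Uy: "?y \<in> star S w"
    by (meson pathstart_in_path_image pathfinish_in_path_image subsetD)+
  \<comment> \<open>A cube with the end point has both \<open>w\<close> and \<open>w'\<close> as
    corners; being convex, it allows the second segment to be replaced by a trail of corners and a
    spur.\<close>
  obtain z where z: "cube_corners z \<subseteq> S" and yz: "?y \<in> cbox (lattice_point z) (lattice_point (z + 1))"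
    using Uy cube_complexE unfolding star_def by blast
  let ?Q = "cbox (lattice_point z) (lattice_point (z + 1))"
  have wz: "w \<in> cube_corners z"
    using near_corner[OF yz] Uy unfolding star_def by blast
  have wz': "w' \<in> cube_corners z"
    using nearest_corner[OF yz] by (simp add: w'_def)
  obtain zs where zs: "trail_in (cube_corners z) zs" "hd zs = w" "last zs = w'"
    using corner_trail[OF wz wz'] .
  have ne: "zs \<noteq> []" and zsQ: "lattice_point ` set zs \<subseteq> ?Q"
    using zs(1) corner_in_cube by (auto simp: trail_in_def)
  let ?A = "linepath ?x (lattice_point w)" and ?B = "linepath (lattice_point w) ?y"
    and ?C = "linepath (lattice_point w') ?y"
  have "homotopic_paths (star S w) g (?A +++ ?B)"
    using star_segment[OF Ux] star_segment[OF Uy] U assms(1)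
    by (intro simply_connected_homotopic[OF star_simply_connected])
       (auto simp: path_image_join closed_segment_commute)
  then have 1: "homotopic_paths ?X g (?A +++ ?B)"
    by (rule homotopic_paths_subset) (auto simp: star_def)
  have "homotopic_paths ?Q ?B (trail_path zs +++ ?C)"
    using path_image_trail_path[OF ne zsQ] zs(2,3) ne yz corner_in_cube[OF wz] corner_in_cube[OF wz']
    by (intro simply_connected_homotopic[OF convex_imp_simply_connected])
       (auto simp: path_image_join path_trail_path pathstart_trail_path pathfinish_trail_path
         dest: closed_segment_subset[OF _ _ convex_box(1)] simp del: linepath_refl)
  then have "homotopic_paths ?X ?B (trail_path zs +++ ?C)"
    by (rule homotopic_paths_subset) (use cube_complexI[OF z] in blast)
  moreover have "homotopic_paths ?X ?A ?A"
    using star_segment[OF Ux] by (auto simp: closed_segment_commute star_def)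
  ultimately have "homotopic_paths ?X (?A +++ ?B) (?A +++ (trail_path zs +++ ?C))"
    by (intro homotopic_paths_join) auto
  with 1 have "homotopic_paths ?X g (?A +++ (trail_path zs +++ ?C))"
    by (rule homotopic_paths_trans)
  then have "near_trail S g zs"
    using zs trail_in_mono[OF zs(1) z] by (simp add: near_trail_def w_def w'_def)
  then show ?thesis ..
qed

text \<open>Uniform continuity cuts the path into \<open>n\<close> pieces, each within 1/2 of its
  start; the pieces are joined by induction.\<close>

lemma near_trail_exists:
  assumes g: "path g" and im: "path_image g \<subseteq> cube_complex S"
  shows "\<exists>zs. near_trail S g zs"
proof -
  have "uniformly_continuous_on {0..1} g"
    using g by (auto intro: compact_uniformly_continuous simp: path_def)
  from this[unfolded uniformly_continuous_on_def, rule_format, of "1 / 2"]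
  obtain d where d: "d > 0" "\<And>s t. \<lbrakk>s \<in> {0..1}; t \<in> {0..1}; dist t s < d\<rbrakk> \<Longrightarrow> dist (g t) (g s) < 1 / 2"
    by auto
  obtain m where "1 / real (Suc m) < d"
    using nat_approx_posE[OF d(1)] .
  then obtain n :: nat where n: "n > 0" "1 / real n < d"
    by blast
  let ?t = "\<lambda>k. real k / real n"
  have "\<exists>zs. near_trail S (subpath 0 (?t k) g) zs" if "k \<le> n" for k
    using that
  proof (induction k)
    case 0
    have "path (subpath 0 0 g)" "path_image (subpath 0 0 g) = {g 0}"
      using path_linepath[of "g 0" "g 0"] by (simp_all add: subpath_refl path_image_subpath)
    moreover have "g 0 \<in> cube_complex S"
      using im by (auto simp: path_image_def)
    ultimately have "\<exists>zs. near_trail S (subpath 0 0 g) zs"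
      by (intro near_trail_small) auto
    then show ?case by simp
  next
    case (Suc k)
    have t: "?t k \<in> {0..1}" "?t (Suc k) \<in> {0..1}" "?t k \<le> ?t (Suc k)"
      using Suc.prems by (auto simp: divide_right_mono)
    obtain zs where zs: "near_trail S (subpath 0 (?t k) g) zs"
      using Suc by auto
    let ?h = "subpath (?t k) (?t (Suc k)) g"
    have "\<exists>ws. near_trail S ?h ws"
    proof (rule near_trail_small)
      show "path ?h" using g t by (auto intro: path_subpath)
      show "path_image ?h \<subseteq> cube_complex S"
        using path_image_subpath_subset[OF t(1,2)] im by blast
      fix x assume "x \<in> path_image ?h"
      then obtain s where s: "x = g s" "?t k \<le> s" "s \<le> ?t (Suc k)"
        using t(3) by (auto simp: path_image_subpath)
      have "?t (Suc k) - ?t k < d"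
        using n by (simp add: diff_divide_distrib[symmetric])
      then have "dist (?t k) s < d" "s \<in> {0..1}"
        using s(2,3) t order_trans[of 0 "?t k" s] by (auto simp: dist_real_def)
      then show "dist (pathstart ?h) x < 1 / 2"
        using d(2)[OF _ t(1)] by (simp add: s(1))
    qed
    then obtain ws where ws: "near_trail S ?h ws" ..
    have "near_trail S (subpath 0 (?t k) g +++ ?h) (zs @ tl ws)"
      by (rule near_trail_join[OF zs ws]) simp
    moreover have "homotopic_paths (cube_complex S) (subpath 0 (?t k) g +++ ?h) (subpath 0 (?t (Suc k)) g)"
      using t by (intro homotopic_join_subpaths[OF g im]) auto
    ultimately show ?case
      using near_trail_homotopic by blast
  qed
  from this[of n] show ?thesis using n by simp
qed

text \<open>For a loop the two spurs are reverses of each other, so the first one is the path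
  \<open>q\<close> along which the base point moves.\<close>

lemma loop_homotopic_trail:
  assumes "path g" and "path_image g \<subseteq> cube_complex S" and "pathfinish g = pathstart g"
  obtains zs q where "closed_trail_in S zs" and "path q" and "path_image q \<subseteq> cube_complex S"
    and "pathstart q = pathstart g" and "pathfinish q = lattice_point (hd zs)"
    and "homotopic_paths (cube_complex S) g (q +++ trail_path zs +++ reversepath q)"
proof -
  obtain zs where zs: "near_trail S g zs"
    using near_trail_exists assms by blast
  have eq: "last zs = hd zs" and tr: "trail_in S zs"
    using zs assms(3) by (auto simp: near_trail_def)
  let ?q = "linepath (pathstart g) (lattice_point (hd zs))"
  have "linepath (lattice_point (last zs)) (pathfinish g) = reversepath ?q"
    by (simp add: eq assms(3))
  moreover have "homotopic_paths (cube_complex S) g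
      (?q +++ (trail_path zs +++ linepath (lattice_point (last zs)) (pathfinish g)))"
    using zs unfolding near_trail_def by blast
  ultimately have "homotopic_paths (cube_complex S) g (?q +++ trail_path zs +++ reversepath ?q)"
    by (simp only:)
  then show thesis
    using tr eq near_trailD(4)[OF zs] by (intro that[of zs ?q]) (auto simp: closed_trail_in_def)
qed

section \<open>Cocycles are locally determined\<close>

lemma mem_box0: "z \<in> box0 r \<longleftrightarrow> (\<forall>i. \<bar>z $ i\<bar> \<le> int r)"
  by (simp add: box0_def)

lemma box0_mono:
  assumes "r \<le> s"
  shows "box0 r \<subseteq> box0 s"
proof
  fix z :: "int ^ 'd" assume z: "z \<in> box0 r"
  have "\<bar>z $ i\<bar> \<le> int s" for i
  proof -
    have "\<bar>z $ i\<bar> \<le> int r" using z by (simp add: mem_box0)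
    then show ?thesis using assms by linarith
  qed
  then show "z \<in> box0 s" by (simp add: mem_box0)
qed

lemma box0_add:
  fixes v w :: "int ^ 'd"
  assumes "v \<in> box0 r" and "w \<in> box0 s"
  shows "v + w \<in> box0 (r + s)"
  unfolding mem_box0
proof
  fix i
  have "\<bar>v $ i\<bar> \<le> int r" "\<bar>w $ i\<bar> \<le> int s"
    using assms by (simp_all add: mem_box0)
  then show "\<bar>(v + w) $ i\<bar> \<le> int (r + s)" by simp
qed

lemma finite_subset_box0:
  assumes "finite F"
  shows "\<exists>r. F \<subseteq> (box0 r :: (int ^ 'd::finite) set)"
  using assms
proof (induction F)
  case (insert z F)
  then obtain r where r: "F \<subseteq> box0 r" by blast
  define m where "m = (\<Sum>i\<in>UNIV. nat \<bar>z $ i\<bar>)"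
  have "nat \<bar>z $ i\<bar> \<le> m" for i
    unfolding m_def by (rule member_le_sum) auto
  then have "z \<in> box0 m"
    unfolding box0_def by (simp add: nat_le_iff)
  then have "z \<in> box0 (max r m)" "F \<subseteq> box0 (max r m)"
    using r box0_mono[of r "max r m"] box0_mono[of m "max r m"] by auto
  then show ?case by blast
qed simp

lemma finite_box0: "finite (box0 r :: (int ^ 'd::finite) set)"
proof (rule finite_subset)
  show "box0 r \<subseteq> (\<lambda>f. \<chi> i. f i) ` (\<Pi>\<^sub>E i\<in>(UNIV :: 'd set). {- int r..int r})"
  proof
    fix z :: "int ^ 'd" assume "z \<in> box0 r"
    then have "($) z \<in> (\<Pi>\<^sub>E i\<in>(UNIV :: 'd set). {- int r..int r})"
      by (simp add: box0_def abs_le_iff minus_le_iff PiE_UNIV_domain)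
    moreover have "z = (\<chi> i. ($) z i)" by simp
    ultimately show "z \<in> (\<lambda>f. \<chi> i. f i) ` (\<Pi>\<^sub>E i\<in>(UNIV :: 'd set). {- int r..int r})"
      by (intro image_eqI[where x = "($) z"])
  qed
  show "finite ((\<lambda>f. \<chi> i. f i) ` (\<Pi>\<^sub>E i\<in>(UNIV :: 'd set). {- int r..int r}))"
    by (intro finite_imageI finite_PiE) auto
qed

lemma unit_steps_box0: "e \<in> unit_steps \<Longrightarrow> e \<in> box0 1"
  unfolding unit_steps_def box0_def by (auto simp: axis_def)

section \<open>Good sites and local extensions by points of the subshift\<close>

lemma pattern_eq_iff:
  "restrict b (box0 r) = pattern a y r \<longleftrightarrow> (\<forall>w\<in>box0 r. b w = a (w + y))"
  unfolding pattern_def shift_def fun_eq_iff by (auto simp: restrict_def)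

lemma shift_mem: "subshift A \<Longrightarrow> b \<in> A \<Longrightarrow> shift v b \<in> A"
  unfolding subshift_def by blast

text \<open>Positivity of \<open>s\<close> matters: every site is good at level 0, even if its
  letter never occurs in \<open>A\<close>. For \<open>s > 0\<close> some admissible radius must
  reach \<open>s\<close>, for otherwise \<open>s - 1\<close> bounds the supremum.\<close>

lemma good_sites_extension:
  assumes y: "y \<in> good_sites A a s" and "s > 0"
  shows "\<exists>b\<in>A. \<forall>w\<in>box0 s. b w = a (w + y)"
proof -
  let ?M = "{enat r | r. pattern a y r \<in> admissible A r}"
  have "\<exists>r\<ge>s. pattern a y r \<in> admissible A r"
  proof (rule ccontr)
    assume no: "\<not> ?thesis"
    have "Sup ?M \<le> enat (s - 1)"
    proof (rule Sup_least)
      fix x assume "x \<in> ?M"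
      then obtain r where "x = enat r" "\<not> s \<le> r"
        using no by blast
      then show "x \<le> enat (s - 1)" by simp
    qed
    moreover have "enat s \<le> Sup ?M"
      using y by (simp add: good_sites_def admissible_radius_def)
    ultimately have "enat s \<le> enat (s - 1)" by (rule order_trans[rotated])
    with \<open>s > 0\<close> show False by simp
  qed
  then obtain r b where "s \<le> r" "b \<in> A" "pattern a y r = restrict b (box0 r)"
    unfolding admissible_def by blast
  then show ?thesis
    using pattern_eq_iff[of b r a y] box0_mono[of s r] by auto
qed

lemma good_sitesI:
  fixes A :: "('a, 'd::finite) config set"
  assumes "b \<in> A" and "\<And>w. w \<in> box0 r \<Longrightarrow> b w = a (w + y)"
  shows "y \<in> good_sites A a r"
proof -
  have "pattern a y r = restrict b (box0 r)"
    using pattern_eq_iff[of b r a y] assms(2) by simp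
  then have "enat r \<in> {enat r | r. pattern a y r \<in> admissible A r}"
    using assms(1) unfolding admissible_def by blast
  then have "enat r \<le> admissible_radius A a y"
    unfolding admissible_radius_def by (rule Sup_upper)
  then show ?thesis by (simp add: good_sites_def)
qed

text \<open>Recentre the extension of \<open>a\<close> around \<open>y\<close> at \<open>w\<close>.
  Goodness passes to neighbouring sites at the cost of their distance.\<close>

lemma good_sites_near:
  fixes A :: "('a::finite, 'd::finite) config set"
  assumes "subshift A" and y: "y \<in> good_sites A a s" and "s > 0" and w: "w \<in> box0 k" and "k + r \<le> s"
  shows "w + y \<in> good_sites A a r"
proof -
  obtain b where b: "b \<in> A" "\<And>u. u \<in> box0 s \<Longrightarrow> b u = a (u + y)"
    using good_sites_extension[OF y \<open>s > 0\<close>] by blast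
  show ?thesis
  proof (rule good_sitesI[of "shift w b"])
    show "shift w b \<in> A" using shift_mem[OF assms(1) b(1)] .
    fix u :: "int ^ 'd" assume "u \<in> box0 r"
    then have "u + w \<in> box0 s"
      using subsetD[OF box0_mono[of "r + k" s] box0_add[of u r w k]] w \<open>k + r \<le> s\<close> by simp
    then show "shift w b u = a (u + (w + y))"
      using b(2)[of "u + w"] by (simp add: shift_def add.assoc)
  qed
qed

lemma good_sites_antimono:
  assumes "r \<le> s"
  shows "good_sites A a s \<subseteq> good_sites A a r"
proof
  fix y assume "y \<in> good_sites A a s"
  moreover have "enat r \<le> enat s" using assms by simp
  ultimately show "y \<in> good_sites A a r"
    unfolding good_sites_def mem_Collect_eq by (rule order_trans[rotated])
qed

text \<open>As \<open>a\<close> may lie outside \<open>A\<close>, cocycles are evaluated at a point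
  of \<open>A\<close> that copies \<open>a\<close> near \<open>y\<close>, with \<open>y\<close>
  moved to the origin. Outside \<open>box0 s\<close> the choice is arbitrary;
  \<open>window_extension\<close> shows that the values used do not see it.\<close>

definition extension :: "('a, 'd::finite) config set \<Rightarrow> ('a, 'd) config \<Rightarrow> nat \<Rightarrow> int ^ 'd \<Rightarrow> ('a, 'd) config" where
  "extension A a s y = (SOME b. b \<in> A \<and> (\<forall>w\<in>box0 s. b w = a (w + y)))"

lemma extension:
  assumes "y \<in> good_sites A a s" and "s > 0"
  shows "extension A a s y \<in> A" and "w \<in> box0 s \<Longrightarrow> extension A a s y w = a (w + y)"
proof -
  have "\<exists>b. b \<in> A \<and> (\<forall>w\<in>box0 s. b w = a (w + y))"
    using good_sites_extension[OF assms] by blast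
  from someI_ex[OF this] have "extension A a s y \<in> A \<and> (\<forall>w\<in>box0 s. extension A a s y w = a (w + y))"
    unfolding extension_def .
  then show "extension A a s y \<in> A" and "w \<in> box0 s \<Longrightarrow> extension A a s y w = a (w + y)"
    by blast+
qed

section \<open>Continuous functions depend on finite windows\<close>

definition determined :: "('a, 'd::finite) config set \<Rightarrow> nat \<Rightarrow> (('a, 'd) config \<Rightarrow> 'g) \<Rightarrow> bool" where
  "determined A R f \<longleftrightarrow> (\<forall>b\<in>A. \<forall>b'\<in>A. (\<forall>w\<in>box0 R. b w = b' w) \<longrightarrow> f b = f b')"

lemma determinedD:
  assumes "determined A R f" and "b \<in> A" and "b' \<in> A" and "\<And>w. w \<in> box0 R \<Longrightarrow> b w = b' w"
  shows "f b = f b'"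
  using assms unfolding determined_def by blast

lemma determined_mono: "determined A R f \<Longrightarrow> R \<le> R' \<Longrightarrow> determined A R' f"
  using box0_mono[of R R'] unfolding determined_def by (meson subsetD)

lemma topspace_config [simp]: "topspace config_topology = UNIV"
  unfolding config_topology_def by simp

text \<open>A closed set of configurations over a finite alphabet is compact, and finitely many
  cylinders, on each of which \<open>f\<close> is constant within \<open>A\<close>, cover it. The
  sum of their radii dominates each of them.\<close>

lemma continuous_determined:
  fixes A :: "('a::finite, 'd::finite) config set"
  assumes A: "closedin config_topology A"
    and f: "continuous_map (subtopology config_topology A) (discrete_topology S) f"
  shows "\<exists>R. determined A R f"
proof -
  \<comment> \<open>Open, for compactness; decided by a box, so that configurations agreeing there
    lie in it together; and with \<open>f\<close> constant on its part in \<open>A\<close>.\<close>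
  define good where "good U \<longleftrightarrow> openin config_topology U \<and>
    (\<exists>R. \<forall>x y. x \<in> U \<longrightarrow> (\<forall>w\<in>box0 R. x w = y w) \<longrightarrow> y \<in> U) \<and> (\<forall>x\<in>U \<inter> A. \<forall>y\<in>U \<inter> A. f x = f y)" for U
  have "compact_space (config_topology :: ('a, 'd) config topology)"
    unfolding config_topology_def
    by (auto intro: compact_space_product_topology[THEN iffD2] simp: compact_space_discrete_topology)
  then have "compactin config_topology A"
    using A closedin_compact_space by blast
  moreover have "A \<subseteq> \<Union>{U. good U}"
  proof
    fix b assume b: "b \<in> A"
    have "f b \<in> S"
      using f b unfolding continuous_map_def by (auto simp: Pi_iff)
    then have "openin (subtopology config_topology A) {x \<in> topspace (subtopology config_topology A). f x \<in> {f b}}"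
      using f by (intro openin_continuous_map_preimage) auto
    then obtain V where V: "openin config_topology V" "{x \<in> A. f x = f b} = V \<inter> A"
      unfolding openin_subtopology by auto
    then have "b \<in> V" using b by blast
    from product_topology_open_contains_basis[OF V(1)[unfolded config_topology_def] this]
    obtain X where X: "b \<in> (\<Pi>\<^sub>E i\<in>UNIV. X i)" "finite {i. X i \<noteq> topspace (discrete_topology (UNIV :: 'a set))}"
      "(\<Pi>\<^sub>E i\<in>UNIV. X i) \<subseteq> V"
      by blast
    obtain R where R: "{i. X i \<noteq> UNIV} \<subseteq> (box0 R :: (int ^ 'd) set)"
      using finite_subset_box0 X(2) by fastforce
    have "good (\<Pi>\<^sub>E i\<in>UNIV. X i)"
      unfolding good_def
    proof (intro conjI exI[of _ R] allI impI ballI)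
      show "openin config_topology (\<Pi>\<^sub>E i\<in>UNIV. X i)"
        unfolding config_topology_def using X(2) by (intro product_topology_basis) auto
      fix x y assume xy: "x \<in> (\<Pi>\<^sub>E i\<in>UNIV. X i)" "\<forall>w\<in>box0 R. x w = y w"
      have "y i \<in> X i" for i
      proof (cases "i \<in> box0 R")
        case True
        then show ?thesis using xy by (metis PiE_mem UNIV_I)
      next
        case False
        then have "X i = UNIV" using R by blast
        then show ?thesis by simp
      qed
      then show "y \<in> (\<Pi>\<^sub>E i\<in>UNIV. X i)" by (simp add: PiE_UNIV_domain)
    next
      fix x y assume "x \<in> (\<Pi>\<^sub>E i\<in>UNIV. X i) \<inter> A" "y \<in> (\<Pi>\<^sub>E i\<in>UNIV. X i) \<inter> A"
      then have "x \<in> V \<inter> A" "y \<in> V \<inter> A" using X(3) by blast+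
      then show "f x = f y" unfolding V(2)[symmetric] by simp
    qed
    then show "b \<in> \<Union>{U. good U}" using X(1) by blast
  qed
  moreover have "\<forall>U\<in>{U. good U}. openin config_topology U"
    by (simp add: good_def)
  ultimately obtain F where F: "finite F" "F \<subseteq> {U. good U}" "A \<subseteq> \<Union>F"
    unfolding compactin_def by meson
  have "\<forall>U\<in>F. \<exists>R. \<forall>x y. x \<in> U \<longrightarrow> (\<forall>w\<in>box0 R. x w = y w) \<longrightarrow> y \<in> U"
    using F(2) unfolding good_def by blast
  then obtain R where R: "\<And>U x y. \<lbrakk>U \<in> F; x \<in> U; \<forall>w\<in>box0 (R U). x w = y w\<rbrakk> \<Longrightarrow> y \<in> U"
    by metis
  have "determined A (\<Sum>U\<in>F. R U) f"
    unfolding determined_def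
  proof (intro ballI impI)
    fix b b' assume b: "b \<in> A" "b' \<in> A" and eq: "\<forall>w\<in>box0 (\<Sum>U\<in>F. R U). b w = b' w"
    obtain U where U: "U \<in> F" "b \<in> U" using b(1) F(3) by blast
    have "R U \<le> (\<Sum>U\<in>F. R U)"
      using F(1) U(1) by (intro member_le_sum) auto
    then have "\<forall>w\<in>box0 (R U). b w = b' w"
      using eq box0_mono by blast
    then have "b' \<in> U" using R U by blast
    moreover have "good U" using F(2) U(1) by blast
    ultimately show "f b = f b'"
      using U(2) b unfolding good_def by blast
  qed
  then show ?thesis ..
qed

section \<open>Windows and local rules of cocycles\<close>

lemma cocycle_continuous:
  assumes "C \<in> cocycles A G"
  shows "continuous_map (subtopology config_topology A) (discrete_topology (carrier G)) (\<lambda>b. C (z, b))"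
proof -
  have "continuous_map (subtopology config_topology A)
      (prod_topology (discrete_topology UNIV) (subtopology config_topology A)) (\<lambda>b. (z, b))"
    by (intro continuous_map_pairedI) auto
  moreover have "continuous_map (prod_topology (discrete_topology UNIV) (subtopology config_topology A))
      (discrete_topology (carrier G)) C"
    using assms unfolding cocycles_def by blast
  ultimately show ?thesis
    using continuous_map_compose by (force simp: o_def)
qed

lemma cocycle_closed: "C \<in> cocycles A G \<Longrightarrow> b \<in> A \<Longrightarrow> C (z, b) \<in> carrier G"
  using cocycle_continuous[of C A G z] unfolding continuous_map_def by (auto simp: Pi_iff)

lemma cocycle_add:
  "C \<in> cocycles A G \<Longrightarrow> b \<in> A \<Longrightarrow> C (y + z, b) = C (y, shift z b) \<otimes>\<^bsub>G\<^esub> C (z, b)"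
  unfolding cocycles_def by blast

lemma cocycle_zero:
  assumes "group G" and C: "C \<in> cocycles A G" and "b \<in> A"
  shows "C (0, b) = \<one>\<^bsub>G\<^esub>"
proof -
  interpret group G by fact
  have "shift 0 b = b" by (simp add: shift_def)
  then have "C (0, b) = C (0, b) \<otimes>\<^bsub>G\<^esub> C (0, b)"
    using cocycle_add[OF C \<open>b \<in> A\<close>, of 0 0] by simp
  then show ?thesis
    using cocycle_closed[OF C \<open>b \<in> A\<close>, of 0] l_cancel_one'[of "C (0, b)" "C (0, b)"] by simp
qed

text \<open>The box of radius 2 contains the unit steps read by a local rule and the displacements
  between the sites nearest to two points at distance less than 2.\<close>

definition window :: "('a, 'd::finite) config set \<Rightarrow> ('a, 'd, 'g) cochain \<Rightarrow> nat \<Rightarrow> bool" where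
  "window A C R \<longleftrightarrow> (\<forall>w\<in>box0 2. determined A R (\<lambda>b. C (w, b)))"

lemma window_mono: "window A C R \<Longrightarrow> R \<le> R' \<Longrightarrow> window A C R'"
  unfolding window_def using determined_mono by blast

lemma cocycle_window:
  fixes A :: "('a::finite, 'd::finite) config set"
  assumes "subshift A" and C: "C \<in> cocycles A G"
  shows "\<exists>R. window A C R"
proof -
  have "\<exists>R. determined A R (\<lambda>b. C (w, b))" for w
    using continuous_determined[OF _ cocycle_continuous[OF C]] assms(1) unfolding subshift_def by blast
  then obtain R where R: "\<And>w. determined A (R w) (\<lambda>b. C (w, b))" by metis
  have "window A C (\<Sum>w\<in>box0 2. R w)"
    unfolding window_def
  proof
    fix w :: "int ^ 'd" assume "w \<in> box0 2"
    then show "determined A (\<Sum>w\<in>box0 2. R w) (\<lambda>b. C (w, b))"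
      by (intro determined_mono[OF R] member_le_sum finite_box0) auto
  qed
  then show ?thesis ..
qed

text \<open>The rule evaluates \<open>C\<close> at a chosen point of \<open>A\<close> with the given
  pattern; its value on patterns not occurring in \<open>A\<close> is irrelevant.
  \<open>max R 1\<close> makes the radius positive.\<close>

lemma local_rule_exists:
  assumes "window A C R"
  shows "\<exists>r c. local_rule A C r c"
proof -
  define r where "r = max R 1"
  define c where "c e P = C (e, SOME b. b \<in> A \<and> restrict b (box0 r) = P)" for e P
  have "C (e, b) = c e (restrict b (box0 r))" if e: "e \<in> unit_steps" and b: "b \<in> A" for e b
  proof -
    define b' where "b' = (SOME b'. b' \<in> A \<and> restrict b' (box0 r) = restrict b (box0 r))"
    have b': "b' \<in> A" "restrict b' (box0 r) = restrict b (box0 r)"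
      using someI[of "\<lambda>b'. b' \<in> A \<and> restrict b' (box0 r) = restrict b (box0 r)" b] b
      unfolding b'_def by blast+
    have "b w = b' w" if "w \<in> box0 R" for w
      using b'(2) box0_mono[of R r] that unfolding r_def by (metis max.cobounded1 restrict_apply' subsetD)
    moreover have "e \<in> box0 2"
      using unit_steps_box0[OF e] box0_mono[of 1 2] by auto
    ultimately have "C (e, b) = C (e, b')"
      using determinedD[of A R "\<lambda>b. C (e, b)" b b'] assms b b'(1) unfolding window_def by blast
    then show ?thesis by (simp add: c_def b'_def)
  qed
  then have "local_rule A C r c"
    unfolding local_rule_def r_def by auto
  then show ?thesis by blast
qed

text \<open>Since one point \<open>b\<close> of the subshift copies \<open>a\<close> around the
  whole trail, all factors are values of \<open>C\<close> on shifts of the same \<open>b\<close>,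
  and the cocycle identity telescopes them.\<close>

lemma trail_value_eq_cocycle:
  assumes "group G" and A: "subshift A" and C: "C \<in> cocycles A G" and c: "local_rule A C r c"
    and b: "b \<in> A" and "trail_in S zs"
    and eq: "\<And>y w. \<lbrakk>y \<in> set zs; w \<in> box0 r\<rbrakk> \<Longrightarrow> b (w + y) = a (w + y)"
  shows "trail_value G c r a zs = C (last zs - hd zs, shift (hd zs) b)"
  using assms(6) eq
proof (induction zs rule: trail_path.induct)
  case 1
  then show ?case by (simp add: trail_in_def)
next
  case (2 z)
  then show ?case using cocycle_zero[OF assms(1) C shift_mem[OF A b]] by simp
next
  case (3 y z zs)
  have yz: "z - y \<in> unit_steps" "trail_in S (z # zs)"
    using "3.prems"(1) by (auto simp: trail_in_Cons)
  have IH: "trail_value G c r a (z # zs) = C (last (z # zs) - z, shift z b)"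
    using "3.IH"[OF yz(2)] "3.prems"(2) by simp
  have "restrict (shift y b) (box0 r) = pattern a y r"
    unfolding pattern_eq_iff using "3.prems"(2)[of y] by (simp add: shift_def)
  then have "c (z - y) (pattern a y r) = C (z - y, shift y b)"
    using c yz(1) shift_mem[OF A b, of y] unfolding local_rule_def by metis
  moreover have "shift z b = shift (z - y) (shift y b)"
    by (simp add: shift_def)
  moreover have "last (z # zs) - y = (last (z # zs) - z) + (z - y)"
    by simp
  ultimately show ?case
    using IH cocycle_add[OF C shift_mem[OF A b, of y], of "last (z # zs) - z" "z - y"]
    by (simp only: trail_value.simps last.simps list.sel list.simps if_False)
qed

text \<open>A point of \<open>A\<close> that agrees with \<open>a\<close> on good sites is a common
  \<open>b\<close> for a sufficiently deep trail. If the trail is closed, its value is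
  \<open>C\<close> at displacement 0, the unit, and so are all conjugates.\<close>

lemma residue_imp_essential:
  assumes "group G" and A: "subshift A" and C: "C \<in> cocycles A G"
    and val: "cocycle_value A G a Y \<omega> C \<xi> g" and "g \<noteq> \<one>\<^bsub>G\<^esub>"
  shows "essential_defect A a"
  unfolding essential_defect_def
proof clarify
  fix k :: nat and a' assume a': "a' \<in> A" "\<forall>z\<in>good_sites A a k. a' z = a z"
  interpret group G by fact
  obtain r c where c: "local_rule A C r c"
    and ev: "\<forall>\<^sub>F s in sequentially. \<exists>zs. represents A a Y \<omega> s \<xi> zs \<and>
           (\<exists>x\<in>carrier G. g = x \<otimes>\<^bsub>G\<^esub> trail_value G c r a zs \<otimes>\<^bsub>G\<^esub> inv\<^bsub>G\<^esub> x)"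
    using val unfolding cocycle_value_def by blast
  \<comment> \<open>At this level the box of radius \<open>r\<close> around each site of the trail
    consists of sites good at level \<open>k\<close>, where \<open>a'\<close> and \<open>a\<close>
    agree; the extra 1 gives \<open>s > 0\<close>.\<close>
  obtain s zs x where s: "s \<ge> r + k + 1" and zs: "represents A a Y \<omega> s \<xi> zs" and x: "x \<in> carrier G"
    "g = x \<otimes>\<^bsub>G\<^esub> trail_value G c r a zs \<otimes>\<^bsub>G\<^esub> inv\<^bsub>G\<^esub> x"
    using eventually_happens[OF eventually_conj[OF ev eventually_ge_at_top[of "r + k + 1"]]] by auto
  have tr: "trail_in (Y \<inter> good_sites A a s) zs" and cl: "last zs = hd zs"
    using zs unfolding represents_def closed_trail_in_def by blast+
  have "a' (w + y) = a (w + y)" if "y \<in> set zs" "w \<in> box0 r" for y w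
  proof -
    have "y \<in> good_sites A a s" using tr that(1) unfolding trail_in_def by blast
    then have "w + y \<in> good_sites A a k"
      using s by (intro good_sites_near[OF A _ _ that(2)]) auto
    then show ?thesis using a'(2) by blast
  qed
  from trail_value_eq_cocycle[OF assms(1) A C c a'(1) tr this]
  have "trail_value G c r a zs = \<one>\<^bsub>G\<^esub>"
    using cocycle_zero[OF assms(1) C shift_mem[OF A a'(1)]] cl by simp
  then show False using x assms(5) by simp
qed

section \<open>Holonomy of a cocycle\<close>

lemma path_class_eq:
  assumes "homotopic_paths S g h"
  shows "path_class S g = path_class S h"
proof -
  have "homotopic_paths S g k \<longleftrightarrow> homotopic_paths S h k" for k
    using homotopic_paths_trans[OF assms, of k] homotopic_paths_trans[OF homotopic_paths_sym[OF assms], of k] by blast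
  then show ?thesis by (simp add: path_class_def)
qed

lemma path_class_self: "path g \<Longrightarrow> path_image g \<subseteq> S \<Longrightarrow> g \<in> path_class S g"
  by (simp add: path_class_def)

lemma pi1_carrierE:
  assumes "X \<in> carrier (pi1 S p)"
  obtains g where "X = path_class S g" and "path g" and "path_image g \<subseteq> S"
    and "pathstart g = p" and "pathfinish g = p"
proof -
  have "\<exists>g. X = path_class S g \<and> path g \<and> path_image g \<subseteq> S \<and> pathstart g = p \<and> pathfinish g = p"
    using assms unfolding pi1_def by simp
  then show thesis using that by (elim exE conjE)
qed

lemma pi1_nonempty:
  assumes "X \<in> carrier (pi1 S p)"
  shows "\<exists>g. g \<in> X"
proof -
  obtain g where "X = path_class S g" "path g" "path_image g \<subseteq> S"
    by (rule pi1_carrierE[OF assms]) (rule that)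
  then have "g \<in> X" using path_class_self by simp
  then show ?thesis by blast
qed

lemma pi1_loop:
  assumes "X \<in> carrier (pi1 S p)" and "g \<in> X"
  shows "path g" and "path_image g \<subseteq> S" and "pathstart g = p" and "pathfinish g = p"
    and "X = path_class S g"
proof -
  obtain h where h: "X = path_class S h" "pathstart h = p" "pathfinish h = p"
    by (rule pi1_carrierE[OF assms(1)]) (rule that)
  then have hg: "homotopic_paths S h g"
    using assms(2) by (simp add: path_class_def)
  show "path g" using homotopic_paths_imp_path[OF hg] by (elim conjE)
  show "path_image g \<subseteq> S" using homotopic_paths_imp_subset[OF hg] by (elim conjE)
  show "pathstart g = p" using homotopic_paths_imp_pathstart[OF hg] h(2) by simp
  show "pathfinish g = p" using homotopic_paths_imp_pathfinish[OF hg] h(3) by simp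
  show "X = path_class S g" using path_class_eq[OF hg] h(1) by simp
qed

text \<open>The product is defined as a union over all representatives; concatenation respects
  homotopy, so all members of the union coincide.\<close>

lemma pi1_mult:
  assumes X: "X \<in> carrier (pi1 S p)" and Y: "Y \<in> carrier (pi1 S p)" and g: "g \<in> X" and h: "h \<in> Y"
  shows "X \<otimes>\<^bsub>pi1 S p\<^esub> Y = path_class S (g +++ h)"
proof -
  have "path_class S (g' +++ h') = path_class S (g +++ h)" if "g' \<in> X" "h' \<in> Y" for g' h'
  proof -
    have "homotopic_paths S g' g" "homotopic_paths S h' h"
      using pi1_loop(5)[OF X that(1)] pi1_loop(5)[OF Y that(2)] g h by (auto simp: path_class_def)
    then show ?thesis
      using pi1_loop(4)[OF X that(1)] pi1_loop(3)[OF Y that(2)]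
      by (intro path_class_eq homotopic_paths_join) simp_all
  qed
  note const = this
  have "X \<otimes>\<^bsub>pi1 S p\<^esub> Y = (\<Union>g'\<in>X. \<Union>h'\<in>Y. path_class S (g' +++ h'))"
    by (simp add: pi1_def)
  also have "\<dots> = (\<Union>g'\<in>X. \<Union>h'\<in>Y. path_class S (g +++ h))"
    by (intro SUP_cong refl const)
  also have "\<dots> = path_class S (g +++ h)"
    using g h by auto
  finally show ?thesis .
qed

lemma pi1_mult_closed:
  assumes X: "X \<in> carrier (pi1 S p)" and Y: "Y \<in> carrier (pi1 S p)"
  shows "X \<otimes>\<^bsub>pi1 S p\<^esub> Y \<in> carrier (pi1 S p)"
proof -
  obtain g h where gh: "g \<in> X" "h \<in> Y"
    using pi1_nonempty[OF X] pi1_nonempty[OF Y] by blast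
  note g = pi1_loop[OF X gh(1)] and h = pi1_loop[OF Y gh(2)]
  have "path (g +++ h) \<and> path_image (g +++ h) \<subseteq> S \<and> pathstart (g +++ h) = p \<and> pathfinish (g +++ h) = p"
    using g(1-4) h(1-4) by (simp add: path_image_join)
  then show ?thesis
    unfolding pi1_mult[OF X Y gh] unfolding pi1_def partial_object.simps by blast
qed

lemma carrier_update: "carrier (P\<lparr>carrier := X\<rparr>) = X"
  by simp

lemma pi1_infinityD:
  assumes "\<xi> \<in> carrier (pi1_infinity A a r0 Y \<omega>)" and "r0 \<le> s"
  shows "t \<in> base_times (level_complex A a Y s) \<omega> \<Longrightarrow> \<xi> s t \<in> carrier (pi1 (level_complex A a Y s) (\<omega> t))"
    and "\<lbrakk>t \<in> base_times (level_complex A a Y s) \<omega>; t' \<in> base_times (level_complex A a Y s) \<omega>; t \<le> t'\<rbrakk>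
      \<Longrightarrow> \<xi> s t' = pi1_transport (level_complex A a Y s) (subpath t t' \<omega>) (\<xi> s t)"
    and "t \<in> base_times (level_complex A a Y (Suc s)) \<omega>
      \<Longrightarrow> \<xi> s t = pi1_incl (level_complex A a Y s) (\<xi> (Suc s) t)"
proof -
  have "carrier (pi1_infinity A a r0 Y \<omega>) =
      {\<xi> \<in> (\<Pi>\<^sub>E r\<in>{r0..}. carrier (pi1_ray (level_complex A a Y r) \<omega>)).
        \<forall>r\<ge>r0. \<forall>t\<in>base_times (level_complex A a Y (Suc r)) \<omega>.
          \<xi> r t = pi1_incl (level_complex A a Y r) (\<xi> (Suc r) t)}"
    unfolding pi1_infinity_def Let_def carrier_update carrier_product_group by (rule refl)
  note carrier_eq = this
  have \<xi>: "\<xi> \<in> (\<Pi>\<^sub>E r\<in>{r0..}. carrier (pi1_ray (level_complex A a Y r) \<omega>))"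
    and incl: "\<forall>r\<ge>r0. \<forall>t\<in>base_times (level_complex A a Y (Suc r)) \<omega>.
          \<xi> r t = pi1_incl (level_complex A a Y r) (\<xi> (Suc r) t)"
    using assms(1)[unfolded carrier_eq mem_Collect_eq, THEN conjunct1]
      assms(1)[unfolded carrier_eq mem_Collect_eq, THEN conjunct2] .
  have \<xi>s: "\<xi> s \<in> carrier (pi1_ray (level_complex A a Y s) \<omega>)"
    using PiE_mem[OF \<xi>, of s] assms(2) by simp
  have ray_eq: "carrier (pi1_ray (level_complex A a Y s) \<omega>) =
      {x \<in> (\<Pi>\<^sub>E t\<in>base_times (level_complex A a Y s) \<omega>. carrier (pi1 (level_complex A a Y s) (\<omega> t))).
        \<forall>t\<in>base_times (level_complex A a Y s) \<omega>. \<forall>t'\<in>base_times (level_complex A a Y s) \<omega>.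
          t \<le> t' \<longrightarrow> x t' = pi1_transport (level_complex A a Y s) (subpath t t' \<omega>) (x t)}"
    unfolding pi1_ray_def Let_def carrier_update carrier_product_group by (rule refl)
  have ray: "\<xi> s \<in> (\<Pi>\<^sub>E t\<in>base_times (level_complex A a Y s) \<omega>. carrier (pi1 (level_complex A a Y s) (\<omega> t)))"
    "\<forall>t\<in>base_times (level_complex A a Y s) \<omega>. \<forall>t'\<in>base_times (level_complex A a Y s) \<omega>.
       t \<le> t' \<longrightarrow> \<xi> s t' = pi1_transport (level_complex A a Y s) (subpath t t' \<omega>) (\<xi> s t)"
    using \<xi>s[unfolded ray_eq mem_Collect_eq, THEN conjunct1]
      \<xi>s[unfolded ray_eq mem_Collect_eq, THEN conjunct2] .
  show "t \<in> base_times (level_complex A a Y s) \<omega> \<Longrightarrow> \<xi> s t \<in> carrier (pi1 (level_complex A a Y s) (\<omega> t))"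
    using ray(1) by (rule PiE_mem)
  show "\<lbrakk>t \<in> base_times (level_complex A a Y s) \<omega>; t' \<in> base_times (level_complex A a Y s) \<omega>; t \<le> t'\<rbrakk>
      \<Longrightarrow> \<xi> s t' = pi1_transport (level_complex A a Y s) (subpath t t' \<omega>) (\<xi> s t)"
    using ray(2) by blast
  show "t \<in> base_times (level_complex A a Y (Suc s)) \<omega>
      \<Longrightarrow> \<xi> s t = pi1_incl (level_complex A a Y s) (\<xi> (Suc s) t)"
    using incl assms(2) by blast
qed

lemma pi1_infinity_mult:
  assumes "r0 \<le> s" and "t \<in> base_times (level_complex A a Y s) \<omega>"
  shows "(\<xi> \<otimes>\<^bsub>pi1_infinity A a r0 Y \<omega>\<^esub> \<eta>) s t = \<xi> s t \<otimes>\<^bsub>pi1 (level_complex A a Y s) (\<omega> t)\<^esub> \<eta> s t"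
  using assms unfolding pi1_infinity_def pi1_ray_def Let_def by simp

lemma level_complex_antimono: "s \<le> s' \<Longrightarrow> level_complex A a Y s' \<subseteq> level_complex A a Y s"
  unfolding level_complex_def using good_sites_antimono[of s s' A a] by (intro cube_complex_mono) blast

lemma base_times_mono: "S \<subseteq> S' \<Longrightarrow> base_times S \<omega> \<subseteq> base_times S' \<omega>"
  unfolding base_times_def by blast

lemma base_times_nonempty:
  assumes "proper_base_ray A a r0 Y \<omega>" and "r0 \<le> s"
  shows "\<exists>t. t \<in> base_times (level_complex A a Y s) \<omega>"
proof -
  have "\<forall>\<^sub>F t in at_top. \<omega> t \<in> level_complex A a Y s"
    using assms unfolding proper_base_ray_def by blast
  then obtain N where "\<And>t. t \<ge> N \<Longrightarrow> \<omega> t \<in> level_complex A a Y s"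
    unfolding eventually_at_top_linorder by blast
  then have "max N 0 \<in> base_times (level_complex A a Y s) \<omega>"
    unfolding base_times_def by auto
  then show ?thesis ..
qed

lemma base_times_segment:
  assumes "proper_base_ray A a r0 Y \<omega>" and "t \<in> base_times S \<omega>" and "t \<le> t'"
  shows "path (subpath t t' \<omega>)" and "path_image (subpath t t' \<omega>) \<subseteq> S"
    and "pathstart (subpath t t' \<omega>) = \<omega> t" and "pathfinish (subpath t t' \<omega>) = \<omega> t'"
proof -
  have t: "0 \<le> t" "\<omega> ` {t..} \<subseteq> S"
    using assms(2) by (auto simp: base_times_def)
  have "continuous_on {0..} \<omega>"
    using assms(1) by (simp add: proper_base_ray_def)
  then have cont: "continuous_on {t..t'} \<omega>"
    by (rule continuous_on_subset) (use t in auto)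
  have "(t' - t) * u + t \<in> {t..t'}" if u: "u \<in> {0..1}" for u :: real
  proof -
    have "0 \<le> (t' - t) * u" "(t' - t) * u \<le> t' - t"
      using assms(3) u by (simp_all add: mult_left_le)
    then show ?thesis by simp
  qed
  then have "(\<lambda>u. (t' - t) * u + t) ` {0..1} \<subseteq> {t..t'}"
    by blast
  moreover have "continuous_on {0..1} (\<lambda>u. (t' - t) * u + t)"
    by (intro continuous_intros)
  ultimately show "path (subpath t t' \<omega>)"
    unfolding path_def subpath_def using continuous_on_compose2[OF cont] by blast
  show "path_image (subpath t t' \<omega>) \<subseteq> S"
  proof -
    have "{t..t'} \<subseteq> {t..}" by auto
    then show ?thesis
      using t(2) assms(3) unfolding path_image_subpath by (simp only: if_True) blast
  qed
qed (simp_all)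

section \<open>The transition function of a cocycle\<close>

definition transition :: "('a, 'd::finite) config set \<Rightarrow> ('a, 'd, 'g) cochain \<Rightarrow> ('a, 'd) config \<Rightarrow> nat
    \<Rightarrow> real ^ 'd \<Rightarrow> real ^ 'd \<Rightarrow> 'g" where
  "transition A C a s x y = C (nearest y - nearest x, extension A a s (nearest x))"

abbreviation hol :: "('a, 'd::finite) config set \<Rightarrow> ('g, 'm) monoid_scheme \<Rightarrow> ('a, 'd, 'g) cochain
    \<Rightarrow> ('a, 'd) config \<Rightarrow> nat \<Rightarrow> (real \<Rightarrow> real ^ 'd) \<Rightarrow> 'g" where
  "hol A G C a s \<equiv> local_transition.holonomy G 2 (transition A C a s)"

lemma nearest_diff:
  fixes x y :: "real ^ 'd::finite"
  assumes "dist x y < 2"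
  shows "nearest y - nearest x \<in> box0 2"
  unfolding mem_box0
proof
  fix i
  have "\<bar>x $ i - y $ i\<bar> < 2"
    using abs_component_diff_le[of x i y] assms by linarith
  then have "\<bar>real_of_int (nearest y $ i) - real_of_int (nearest x $ i)\<bar> < 3"
    using nearest_dist[of x i] nearest_dist[of y i] by linarith
  then have "\<bar>nearest y $ i - nearest x $ i\<bar> < 3" by linarith
  then show "\<bar>(nearest y - nearest x) $ i\<bar> \<le> int 2" by simp
qed

text \<open>Independence of the choice in \<open>extension\<close>: for displacements in
  \<open>box0 2\<close> the cocycle reads only the box of radius \<open>R\<close>, where every
  candidate copies \<open>a\<close>.\<close>

lemma window_extension:
  assumes "window A C R" and "y \<in> good_sites A a s" and "s > 0" and "R \<le> s" and "b \<in> A"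
    and "\<And>k. k \<in> box0 R \<Longrightarrow> b k = a (k + y)" and "w \<in> box0 2"
  shows "C (w, extension A a s y) = C (w, b)"
proof -
  have "determined A R (\<lambda>b. C (w, b))"
    using assms(1,7) by (simp add: window_def)
  moreover have "extension A a s y k = b k" if "k \<in> box0 R" for k
    using extension(2)[OF assms(2,3) subsetD[OF box0_mono[OF assms(4)] that]] assms(6)[OF that] by simp
  ultimately show ?thesis
    by (rule determinedD[OF _ extension(1)[OF assms(2,3)] assms(5)])
qed

text \<open>After a move within \<open>box0 2\<close>, the box of radius \<open>R\<close> around the
  new site still lies where the old extension copies \<open>a\<close>; this is the origin of
  \<open>R + 2\<close>.\<close>

lemma extension_shift:
  fixes A :: "('a, 'd::finite) config set"
  assumes "u \<in> good_sites A a s" and "s > 0" and "v - u \<in> box0 2" and "R + 2 \<le> s" and "k \<in> box0 R"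
  shows "shift (v - u) (extension A a s u) k = a (k + v)"
proof -
  have "k + (v - u) \<in> box0 s"
    using box0_mono[OF assms(4)] box0_add[OF assms(5,3)] by blast
  from extension(2)[OF assms(1,2) this] show ?thesis
    by (simp add: shift_def)
qed

text \<open>Flatness is the cocycle identity at the extension around the first site. The identity
  produces a shift of that extension where the second transition uses its own; the window cannot
  tell them apart.\<close>

lemma local_transition_cocycle:
  fixes A :: "('a::finite, 'd::finite) config set"
  assumes "group G" and A: "subshift A" and C: "C \<in> cocycles A G" and R: "window A C R" "R + 2 \<le> s"
    and S: "S \<subseteq> good_sites A a s"
  shows "local_transition G (cube_complex S) 2 (transition A C a s)"
proof (rule local_transition.intro[OF assms(1)], rule local_transition_axioms.intro)
  have good: "nearest x \<in> good_sites A a s" if "x \<in> cube_complex S" for x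
    using nearest_in[OF that] S by blast
  have s: "s > 0" "R \<le> s" using R(2) by auto
  show "transition A C a s x y \<in> carrier G" if "x \<in> cube_complex S" for x y
    unfolding transition_def using extension(1)[OF good[OF that] s(1)] by (rule cocycle_closed[OF C])
  fix x y z :: "real ^ 'd"
  assume X: "x \<in> cube_complex S" "y \<in> cube_complex S" "z \<in> cube_complex S"
    and d: "dist x y < 2" "dist y z < 2" "dist x z < 2"
  let ?u = "nearest x" and ?v = "nearest y" and ?w = "nearest z"
  let ?e = "extension A a s"
  have eu: "?e ?u \<in> A" using extension(1)[OF good[OF X(1)] s(1)] .
  have "C (?w - ?v, ?e ?v) = C (?w - ?v, shift (?v - ?u) (?e ?u))"
    by (rule window_extension[OF R(1) good[OF X(2)] s shift_mem[OF A eu] _ nearest_diff[OF d(2)]])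
       (rule extension_shift[OF good[OF X(1)] s(1) nearest_diff[OF d(1)] R(2)])
  moreover have "?w - ?u = (?w - ?v) + (?v - ?u)" by simp
  ultimately show "transition A C a s x z = transition A C a s y z \<otimes>\<^bsub>G\<^esub> transition A C a s x y"
    unfolding transition_def using cocycle_add[OF C eu, of "?w - ?v" "?v - ?u"] by (simp only:)
qed simp

lemma dist_in_segment:
  fixes p q :: "'p::real_normed_vector"
  assumes "x \<in> closed_segment p q" and "y \<in> closed_segment p q"
  shows "dist x y \<le> dist p q"
proof -
  obtain u where u: "0 \<le> u" "u \<le> 1" "x = (1 - u) *\<^sub>R p + u *\<^sub>R q"
    using assms(1) by (auto simp: in_segment)
  obtain v where v: "0 \<le> v" "v \<le> 1" "y = (1 - v) *\<^sub>R p + v *\<^sub>R q"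
    using assms(2) by (auto simp: in_segment)
  have "x - y = (v - u) *\<^sub>R (p - q)"
    by (simp add: u(3) v(3) algebra_simps)
  then have "dist x y = \<bar>v - u\<bar> * dist p q"
    by (simp add: dist_norm)
  also have "\<dots> \<le> dist p q"
    using u v by (intro mult_left_le_one_le) auto
  finally show ?thesis .
qed

lemma dist_unit_step:
  fixes y z :: "int ^ 'a::finite"
  assumes "z - y \<in> unit_steps"
  shows "dist (lattice_point y) (lattice_point z) = 1"
proof -
  obtain i where "z - y = axis i 1 \<or> z - y = - axis i 1"
    using assms unfolding unit_steps_def by blast
  moreover have "lattice_point z - lattice_point y = (\<chi> j. real_of_int ((z - y) $ j))"
    by (simp add: lattice_point_def vec_eq_iff)
  moreover have "(\<chi> j. real_of_int ((axis i 1 :: int ^ 'a) $ j)) = axis i 1"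
    "(\<chi> j. real_of_int ((- axis i 1 :: int ^ 'a) $ j)) = - axis i 1"
    by (simp_all add: axis_def vec_eq_iff)
  ultimately have "lattice_point z - lattice_point y = axis i 1 \<or> lattice_point z - lattice_point y = - axis i 1"
    by metis
  then have "norm (lattice_point z - lattice_point y) = 1"
    by (auto simp: norm_axis_1)
  then show ?thesis by (simp add: dist_norm norm_minus_commute)
qed

text \<open>Two levels occur: the transitions are read at level \<open>s\<close>, while the trail is
  good at level \<open>k\<close>, large enough for the radius \<open>r\<close> of the local rule. An
  edge has length 1, below the scale 2, so \<open>holonomy_close\<close> covers it.\<close>

lemma hol_trail_path:
  fixes A :: "('a::finite, 'd::finite) config set"
  assumes "group G" and A: "subshift A" and C: "C \<in> cocycles A G" and R: "window A C R" "R + 2 \<le> s"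
    and S: "S \<subseteq> good_sites A a s" and c: "local_rule A C r c" and k: "r \<le> k" "R \<le> k"
    and "trail_in (good_sites A a k) zs" and "path_image (trail_path zs) \<subseteq> cube_complex S"
  shows "hol A G C a s (trail_path zs) = trail_value G c r a zs"
proof -
  interpret local_transition G "cube_complex S" 2 "transition A C a s"
    by (rule local_transition_cocycle[OF assms(1) A C R S])
  show ?thesis
    using assms(10,11)
  proof (induction zs rule: trail_path.induct)
    case 1
    then show ?case by (simp add: trail_in_def)
  next
    case (2 z)
    have "lattice_point z \<in> cube_complex S"
      using 2 by simp
    then have "holonomy (linepath (lattice_point z) (lattice_point z)) = \<one>\<^bsub>G\<^esub>"
      using holonomy_close[of "linepath (lattice_point z) (lattice_point z)"] T_refl by (simp add: path_def)
    then show ?case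
      by (simp only: trail_path.simps trail_value.simps)
  next
    case (3 y z zs)
    let ?e = "linepath (lattice_point y) (lattice_point z)"
    have im: "path_image ?e \<subseteq> cube_complex S" "path_image (trail_path (z # zs)) \<subseteq> cube_complex S"
      using "3.prems"(2) by (auto simp: path_image_join pathstart_trail_path)
    have st: "y \<in> good_sites A a k" "z - y \<in> unit_steps" "trail_in (good_sites A a k) (z # zs)"
      using "3.prems"(1) by (auto simp: trail_in_Cons)
    have k0: "k > 0" and s: "s > 0" "R \<le> s"
      using c k R(2) by (auto simp: local_rule_def)
    have step: "z - y \<in> box0 2"
      using unit_steps_box0[OF st(2)] box0_mono[of 1 2] by auto
    have "lattice_point y \<in> cube_complex S"
      using im(1) by auto
    then have y: "y \<in> good_sites A a s"
      using nearest_in[of "lattice_point y" S] S by auto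
    have "dist p q < 2" if "p \<in> path_image ?e" "q \<in> path_image ?e" for p q
      using dist_in_segment[of p "lattice_point y" "lattice_point z" q] that dist_unit_step[OF st(2)] by simp
    then have "holonomy ?e = transition A C a s (lattice_point y) (lattice_point z)"
      using holonomy_close[of ?e] im(1) by simp
    also have "\<dots> = C (z - y, extension A a s y)"
      by (simp add: transition_def)
    \<comment> \<open>Both extensions copy \<open>a\<close> on the box of radius \<open>R\<close>,
      which is all that \<open>C\<close> sees; the one at level \<open>k\<close> copies it on the
      box of radius \<open>r\<close> too.\<close>
    also have "\<dots> = C (z - y, extension A a k y)"
      using extension[OF st(1) k0] box0_mono[OF k(2)] by (intro window_extension[OF R(1) y s] step) auto
    also have "\<dots> = c (z - y) (restrict (extension A a k y) (box0 r))"
      using c st(2) extension(1)[OF st(1) k0] unfolding local_rule_def by blast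
    also have "restrict (extension A a k y) (box0 r) = pattern a y r"
      unfolding pattern_eq_iff using extension(2)[OF st(1) k0] box0_mono[OF k(1)] by blast
    finally have e: "holonomy ?e = c (z - y) (pattern a y r)" .
    have "holonomy (trail_path (y # z # zs)) = holonomy (trail_path (z # zs)) \<otimes>\<^bsub>G\<^esub> holonomy ?e"
      unfolding trail_path.simps(3)
      by (rule holonomy_join) (use im in \<open>auto simp: path_trail_path pathstart_trail_path\<close>)
    then show ?case
      using "3.IH"[OF st(3) im(2)] e by simp
  qed
qed

section \<open>The residue for abelian groups\<close>

lemma pi1_homotopic_closed:
  assumes X: "X \<in> carrier (pi1 S p)" and g: "g \<in> X" and "homotopic_paths S g h"
  shows "h \<in> X"
  unfolding pi1_loop(5)[OF X g] using assms(3) by (simp add: path_class_def)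

lemma pi1_homotopic:
  assumes X: "X \<in> carrier (pi1 S p)" and g: "g \<in> X" and h: "h \<in> X"
  shows "homotopic_paths S g h"
  using h unfolding pi1_loop(5)[OF X g] by (simp add: path_class_def)

text \<open>The class induced by inclusion contains the given path itself, so the same path
  represents the element on every shallower level.\<close>

lemma pi1_infinity_incl:
  assumes \<xi>: "\<xi> \<in> carrier (pi1_infinity A a r0 Y \<omega>)" and "r0 \<le> s" and "s \<le> s'"
    and "t \<in> base_times (level_complex A a Y s') \<omega>" and "p \<in> \<xi> s' t"
  shows "p \<in> \<xi> s t"
  using assms(3-5)
proof (induction s' rule: dec_induct)
  case (step n)
  let ?X = "level_complex A a Y"
  have sub: "?X (Suc n) \<subseteq> ?X n" by (rule level_complex_antimono) simp
  have r0: "r0 \<le> n" "r0 \<le> Suc n" using assms(2) step.hyps by auto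
  have t: "t \<in> base_times (?X n) \<omega>"
    using step.prems(1) base_times_mono[OF sub] by blast
  have "path p" "path_image p \<subseteq> ?X n"
    using pi1_loop(1,2)[OF pi1_infinityD(1)[OF \<xi> r0(2) step.prems(1)] step.prems(2)] sub by auto
  then have "p \<in> pi1_incl (?X n) (\<xi> (Suc n) t)"
    using path_class_self step.prems(2) unfolding pi1_incl_def by blast
  then have "p \<in> \<xi> n t"
    unfolding pi1_infinityD(3)[OF \<xi> r0(1) step.prems(1)] .
  then show ?case using step.IH t by blast
qed

lemma closed_trailD:
  assumes "closed_trail_in S zs"
  shows "trail_in S zs" and "zs \<noteq> []" and "last zs = hd zs"
proof -
  show "trail_in S zs" and "last zs = hd zs"
    using assms by (simp_all add: closed_trail_in_def)
  then show "zs \<noteq> []" unfolding trail_in_def by (elim conjE)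
qed

locale residue_setting = comm_group G
  for G :: "('g, 'm) monoid_scheme" (structure) +
  fixes A :: "('a::finite, 'd::finite) config set" and a :: "('a, 'd) config"
    and r0 :: nat and Y :: "(int ^ 'd) set" and \<omega> :: "real \<Rightarrow> real ^ 'd"
  assumes subshift: "subshift A" and ray: "proper_base_ray A a r0 Y \<omega>"
begin

abbreviation level :: "nat \<Rightarrow> (real ^ 'd) set" where
  "level s \<equiv> level_complex A a Y s"

abbreviation value_on :: "('a, 'd, 'g) cochain \<Rightarrow> (nat \<Rightarrow> real \<Rightarrow> (real \<Rightarrow> real ^ 'd) set) \<Rightarrow> 'g \<Rightarrow> bool" where
  "value_on \<equiv> cocycle_value A G a Y \<omega>"

lemma local_transition_level:
  assumes "C \<in> cocycles A G" and "window A C R" and "R + 2 \<le> s"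
  shows "local_transition G (level s) 2 (transition A C a s)"
  unfolding level_complex_def
  by (rule local_transition_cocycle[OF is_group subshift assms]) blast

lemma conj_eq: "x \<in> carrier G \<Longrightarrow> y \<in> carrier G \<Longrightarrow> x \<otimes> y \<otimes> inv x = y"
  by (simp add: m_comm[of x y] m_assoc)

text \<open>Moving the base point conjugates the holonomy by that of the segment of the ray, and
  commutativity removes the conjugation.\<close>

lemma holonomy_base_time:
  assumes T: "local_transition G (level s) 2 T"
    and \<xi>: "\<xi> \<in> carrier (pi1_infinity A a r0 Y \<omega>)" and s: "r0 \<le> s"
    and t: "t \<in> base_times (level s) \<omega>" "t' \<in> base_times (level s) \<omega>" "t \<le> t'"
    and p: "p \<in> \<xi> s t" and p': "p' \<in> \<xi> s t'"
  shows "local_transition.holonomy G 2 T p' = local_transition.holonomy G 2 T p"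
proof -
  interpret local_transition G "level s" 2 T by (rule T)
  define q where "q = subpath t t' \<omega>"
  note q = base_times_segment[OF ray t(1,3), folded q_def]
  note X = pi1_infinityD(1)[OF \<xi> s t(1)]
  have "p' \<in> pi1_transport (level s) q (\<xi> s t)"
    using p' unfolding pi1_infinityD(2)[OF \<xi> s t] q_def .
  then obtain g where g: "g \<in> \<xi> s t" and "homotopic_paths (level s) (reversepath q +++ (g +++ q)) p'"
    unfolding pi1_transport_def path_class_def by blast
  then have "holonomy p' = holonomy (reversepath q +++ (g +++ q))"
    by (simp add: holonomy_homotopic)
  also have "\<dots> = holonomy (g +++ q) \<otimes> holonomy (reversepath q)"
    using q pi1_loop[OF X g] by (intro holonomy_join) (auto simp: path_image_join)
  also have "\<dots> = (holonomy q \<otimes> holonomy g) \<otimes> inv (holonomy q)"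
    using q pi1_loop[OF X g] by (simp add: holonomy_join holonomy_reversepath)
  also have "\<dots> = holonomy g"
    using q pi1_loop[OF X g] by (intro conj_eq holonomy_closed)
  also have "\<dots> = holonomy p"
    by (rule holonomy_homotopic[OF pi1_homotopic[OF X g p]])
  finally show ?thesis .
qed

text \<open>Regard \<open>p\<close> as a loop of level \<open>s\<close>, then move the base point
  along the ray, in whichever direction the times are ordered.\<close>

lemma holonomy_const:
  assumes T: "local_transition G (level s) 2 T"
    and \<xi>: "\<xi> \<in> carrier (pi1_infinity A a r0 Y \<omega>)" and s: "r0 \<le> s"
    and t0: "t0 \<in> base_times (level s) \<omega>" "p0 \<in> \<xi> s t0"
    and s': "s \<le> s'" and t: "t \<in> base_times (level s') \<omega>" "p \<in> \<xi> s' t"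
  shows "local_transition.holonomy G 2 T p = local_transition.holonomy G 2 T p0"
proof -
  have p: "p \<in> \<xi> s t"
    by (rule pi1_infinity_incl[OF \<xi> s s' t])
  have "t \<in> base_times (level s) \<omega>"
    using t(1) base_times_mono[OF level_complex_antimono[OF s']] by blast
  then show ?thesis
    using holonomy_base_time[OF T \<xi> s t0(1) _ _ t0(2) p] holonomy_base_time[OF T \<xi> s _ t0(1) _ p t0(2)]
    by (cases "t0 \<le> t") auto
qed

text \<open>The hypotheses on \<open>\<xi>\<close> are levelwise, so that the statement applies to a
  product of two limit elements as well. The local rule is arbitrary, as the holonomy at level
  \<open>s\<close> is defined without one.\<close>

lemma cocycle_value_iff:
  assumes C: "C \<in> cocycles A G" and R: "window A C R" "R + 2 \<le> s" and s: "r0 \<le> s"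
    and \<xi>: "\<And>s' t. \<lbrakk>s \<le> s'; t \<in> base_times (level s') \<omega>\<rbrakk> \<Longrightarrow> \<xi> s' t \<in> carrier (pi1 (level s') (\<omega> t))"
    and const: "\<And>s' t p. \<lbrakk>s \<le> s'; t \<in> base_times (level s') \<omega>; p \<in> \<xi> s' t\<rbrakk> \<Longrightarrow> hol A G C a s p = \<gamma>"
  shows "value_on C \<xi> g \<longleftrightarrow> g = \<gamma>"
proof -
  interpret local_transition G "level s" 2 "transition A C a s"
    by (rule local_transition_level[OF C R])
  \<comment> \<open>The connecting path contributes its holonomy and the inverse, which cancel by
    commutativity; the trail in between gives its value by \<open>hol_trail_path\<close>.\<close>
  have loop: "holonomy (q +++ trail_path zs +++ reversepath q) = trail_value G c r a zs
      \<and> trail_value G c r a zs \<in> carrier G"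
    if c: "local_rule A C r c" and s': "s \<le> s'" "r \<le> s'" and zs: "closed_trail_in (Y \<inter> good_sites A a s') zs"
      and q: "path q" "path_image q \<subseteq> level s'" "pathfinish q = lattice_point (hd zs)"
      and im: "path_image (trail_path zs) \<subseteq> level s'" for r c s' zs q
  proof -
    have sub: "level s' \<subseteq> level s" by (rule level_complex_antimono[OF s'(1)])
    have tr: "trail_in (good_sites A a s') zs" "zs \<noteq> []" "last zs = hd zs"
      using closed_trailD[OF zs] trail_in_mono[OF _ Int_lower2] by blast+
    have ends: "pathstart (trail_path zs) = pathfinish q" "pathfinish (trail_path zs) = pathfinish q"
      using tr q(3) by (simp_all add: pathstart_trail_path pathfinish_trail_path)
    have imq: "path_image q \<subseteq> level s" and imt: "path_image (trail_path zs) \<subseteq> level s"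
      using q(2) im sub by auto
    have "R \<le> s'" using R(2) s'(1) by simp
    from hol_trail_path[OF is_group subshift C R Int_lower2 c s'(2) this tr(1) imt[unfolded level_complex_def]]
    have e: "holonomy (trail_path zs) = trail_value G c r a zs" .
    have cl: "holonomy (trail_path zs) \<in> carrier G" "holonomy q \<in> carrier G"
      using holonomy_closed path_trail_path imt imq q(1) by auto
    have "holonomy (q +++ (trail_path zs +++ reversepath q)) = holonomy (trail_path zs +++ reversepath q) \<otimes> holonomy q"
      using ends imq imt q(1) by (intro holonomy_join) (auto simp: path_image_join path_trail_path)
    also have "holonomy (trail_path zs +++ reversepath q) = inv (holonomy q) \<otimes> holonomy (trail_path zs)"
      using ends imq imt q(1) holonomy_reversepath[OF q(1) imq]
      by (subst holonomy_join) (auto simp: path_trail_path)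
    also have "inv (holonomy q) \<otimes> holonomy (trail_path zs) \<otimes> holonomy q = holonomy (trail_path zs)"
      using conj_eq[of "inv (holonomy q)" "holonomy (trail_path zs)"] cl by simp
    finally show ?thesis using e cl(1) by simp
  qed
  show ?thesis
  proof
    assume "value_on C \<xi> g"
    then obtain r c where c: "local_rule A C r c"
      and ev: "\<forall>\<^sub>F s in sequentially. \<exists>zs. represents A a Y \<omega> s \<xi> zs \<and>
           (\<exists>x\<in>carrier G. g = x \<otimes> trail_value G c r a zs \<otimes> inv x)"
      unfolding cocycle_value_def by blast
    \<comment> \<open>From \<open>s + r\<close> on, the trail lies inside level \<open>s\<close>,
      where the holonomy is computed, and is good enough for a local rule of radius
      \<open>r\<close>.\<close>
    obtain s' zs x where s': "s + r \<le> s'" and zs: "represents A a Y \<omega> s' \<xi> zs" and x: "x \<in> carrier G"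
      "g = x \<otimes> trail_value G c r a zs \<otimes> inv x"
      using eventually_happens[OF eventually_conj[OF ev eventually_ge_at_top[of "s + r"]]] by auto
    obtain t q where t: "t \<in> base_times (level s') \<omega>" and q: "path q" "path_image q \<subseteq> level s'"
        "pathfinish q = lattice_point (hd zs)"
      and mem: "q +++ trail_path zs +++ reversepath q \<in> \<xi> s' t"
      and cl: "closed_trail_in (Y \<inter> good_sites A a s') zs"
      using zs unfolding represents_def by blast
    have le: "s \<le> s'" "r \<le> s'" using s' by auto
    have ne: "zs \<noteq> []" "last zs = hd zs"
      using closed_trailD[OF cl] by simp_all
    have "path_image (q +++ trail_path zs +++ reversepath q) \<subseteq> level s'"
      using pi1_loop(2)[OF \<xi>[OF le(1) t] mem] .
    then have im: "path_image (trail_path zs) \<subseteq> level s'"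
      using ne q(3) by (simp add: path_image_join pathstart_trail_path pathfinish_trail_path)
    note l = loop[OF c le cl q im]
    have "g = trail_value G c r a zs"
      using x l conj_eq by simp
    then show "g = \<gamma>"
      using l const[OF le(1) t mem] by simp
  next
    assume g: "g = \<gamma>"
    obtain r c where c: "local_rule A C r c"
      using local_rule_exists[OF R(1)] by blast
    \<comment> \<open>Representing trails exist on every deep level by
      \<open>loop_homotopic_trail\<close>; the conjugating element is the unit.\<close>
    have "\<exists>zs. represents A a Y \<omega> s' \<xi> zs \<and> (\<exists>x\<in>carrier G. g = x \<otimes> trail_value G c r a zs \<otimes> inv x)"
      if s': "s + r \<le> s'" for s'
    proof -
      have le: "s \<le> s'" "r \<le> s'" "r0 \<le> s'" using s' s by auto
      obtain t where t: "t \<in> base_times (level s') \<omega>"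
        using base_times_nonempty[OF ray le(3)] by blast
      note X = \<xi>[OF le(1) t]
      obtain p where p: "p \<in> \<xi> s' t" using pi1_nonempty[OF X] by blast
      note P = pi1_loop[OF X p]
      obtain zs q where zs: "closed_trail_in (Y \<inter> good_sites A a s') zs" and q: "path q" "path_image q \<subseteq> level s'"
          "pathstart q = pathstart p" "pathfinish q = lattice_point (hd zs)"
        and h: "homotopic_paths (level s') p (q +++ trail_path zs +++ reversepath q)"
        using loop_homotopic_trail[OF P(1) P(2)[unfolded level_complex_def]] P(3,4)
        unfolding level_complex_def by metis
      have mem: "q +++ trail_path zs +++ reversepath q \<in> \<xi> s' t"
        by (rule pi1_homotopic_closed[OF X p h])
      have rep: "represents A a Y \<omega> s' \<xi> zs"
        unfolding represents_def using zs t q mem P(3) by auto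
      have ne: "zs \<noteq> []" "last zs = hd zs"
        using closed_trailD[OF zs] by simp_all
      have im: "path_image (trail_path zs) \<subseteq> level s'"
        using homotopic_paths_imp_subset[OF h] ne q(4)
        by (simp add: path_image_join pathstart_trail_path pathfinish_trail_path)
      note l = loop[OF c le(1,2) zs q(1,2,4) im]
      have "g = \<one> \<otimes> trail_value G c r a zs \<otimes> inv \<one>"
        using l const[OF le(1) t mem] g by simp
      then show ?thesis using rep one_closed by blast
    qed
    then have "\<forall>\<^sub>F s' in sequentially. \<exists>zs. represents A a Y \<omega> s' \<xi> zs \<and>
           (\<exists>x\<in>carrier G. g = x \<otimes> trail_value G c r a zs \<otimes> inv x)"
      unfolding eventually_sequentially by blast
    then show "value_on C \<xi> g"
      unfolding cocycle_value_def using c by blast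
  qed
qed

lemma value_on_holonomy:
  assumes C: "C \<in> cocycles A G" and R: "window A C R" "R + 2 \<le> s" and s: "r0 \<le> s"
    and \<xi>: "\<xi> \<in> carrier (pi1_infinity A a r0 Y \<omega>)" and t: "t \<in> base_times (level s) \<omega>" and p: "p \<in> \<xi> s t"
  shows "value_on C \<xi> g \<longleftrightarrow> g = hol A G C a s p"
proof (rule cocycle_value_iff[OF C R s])
  fix s' t' assume "s \<le> s'" "t' \<in> base_times (level s') \<omega>"
  then show "\<xi> s' t' \<in> carrier (pi1 (level s') (\<omega> t'))"
    using pi1_infinityD(1)[OF \<xi>] s by simp
next
  fix s' t' p' assume "s \<le> s'" "t' \<in> base_times (level s') \<omega>" "p' \<in> \<xi> s' t'"
  then show "hol A G C a s p' = hol A G C a s p"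
    by (rule holonomy_const[OF local_transition_level[OF C R] \<xi> s t p])
qed

lemma loop_exists:
  assumes \<xi>: "\<xi> \<in> carrier (pi1_infinity A a r0 Y \<omega>)" and s: "r0 \<le> s"
  obtains t p where "t \<in> base_times (level s) \<omega>" and "p \<in> \<xi> s t"
    and "path p" and "path_image p \<subseteq> level s" and "pathfinish p = pathstart p"
proof -
  obtain t where t: "t \<in> base_times (level s) \<omega>"
    using base_times_nonempty[OF ray s] by blast
  note X = pi1_infinityD(1)[OF \<xi> s t]
  obtain p where p: "p \<in> \<xi> s t" using pi1_nonempty[OF X] by blast
  then show thesis
    using that[OF t p] pi1_loop[OF X p] by simp
qed

lemma value_exists:
  assumes C: "C \<in> cocycles A G" and \<xi>: "\<xi> \<in> carrier (pi1_infinity A a r0 Y \<omega>)"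
  shows "\<exists>\<gamma>\<in>carrier G. \<forall>g. value_on C \<xi> g \<longleftrightarrow> g = \<gamma>"
proof -
  obtain R where R: "window A C R" using cocycle_window[OF subshift C] by blast
  \<comment> \<open>From \<open>r0\<close> on, the limit has components and the ray has base times;
    from \<open>R + 2\<close> on, the transition function is flat.\<close>
  define s where "s = max r0 (R + 2)"
  have s: "r0 \<le> s" "R + 2 \<le> s" by (auto simp: s_def)
  interpret local_transition G "level s" 2 "transition A C a s"
    by (rule local_transition_level[OF C R s(2)])
  obtain t p where p: "t \<in> base_times (level s) \<omega>" "p \<in> \<xi> s t" "path p" "path_image p \<subseteq> level s"
    by (rule loop_exists[OF \<xi> s(1)]) (rule that)
  show ?thesis
    using value_on_holonomy[OF C R s(2,1) \<xi> p(1,2)] holonomy_closed[OF p(3,4)] by blast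
qed

lemma Res_eqI:
  assumes "X \<noteq> {}" and "\<And>C g. C \<in> X \<Longrightarrow> value_on C \<xi> g \<longleftrightarrow> g = \<gamma>"
  shows "Res A G a Y \<omega> X \<xi> = \<gamma>"
  unfolding Res_def
proof (rule the_equality)
  obtain C where "C \<in> X" using assms(1) by blast
  then show "\<exists>C\<in>X. value_on C \<xi> \<gamma>"
    using assms(2)[of C \<gamma>] by blast
  fix g assume "\<exists>C\<in>X. value_on C \<xi> g"
  then obtain C where "C \<in> X" "value_on C \<xi> g" by blast
  then show "g = \<gamma>" using assms(2)[of C g] by simp
qed

text \<open>The residue of the singleton \<open>{C}\<close> serves as a name for the value of an
  individual cocycle, before any passage to classes.\<close>

lemma value_on_iff:
  assumes "C \<in> cocycles A G" and "\<xi> \<in> carrier (pi1_infinity A a r0 Y \<omega>)"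
  shows "value_on C \<xi> g \<longleftrightarrow> g = Res A G a Y \<omega> {C} \<xi>" and "Res A G a Y \<omega> {C} \<xi> \<in> carrier G"
proof -
  obtain \<gamma> where \<gamma>: "\<gamma> \<in> carrier G" "\<And>g. value_on C \<xi> g \<longleftrightarrow> g = \<gamma>"
    using value_exists[OF assms] by blast
  then have "Res A G a Y \<omega> {C} \<xi> = \<gamma>"
    by (intro Res_eqI) auto
  then show "value_on C \<xi> g \<longleftrightarrow> g = Res A G a Y \<omega> {C} \<xi>" and "Res A G a Y \<omega> {C} \<xi> \<in> carrier G"
    using \<gamma> by simp_all
qed

text \<open>Concatenating representatives multiplies their holonomies in reverse order;
  commutativity restores the order.\<close>

lemma value_on_loop_mult:
  assumes C: "C \<in> cocycles A G" and \<xi>: "\<xi> \<in> carrier (pi1_infinity A a r0 Y \<omega>)"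
    and \<eta>: "\<eta> \<in> carrier (pi1_infinity A a r0 Y \<omega>)"
  shows "value_on C (\<xi> \<otimes>\<^bsub>pi1_infinity A a r0 Y \<omega>\<^esub> \<eta>) g \<longleftrightarrow>
    g = Res A G a Y \<omega> {C} \<xi> \<otimes> Res A G a Y \<omega> {C} \<eta>"
proof -
  obtain R where R: "window A C R" using cocycle_window[OF subshift C] by blast
  define s where "s = max r0 (R + 2)"
  have s: "r0 \<le> s" "R + 2 \<le> s" by (auto simp: s_def)
  interpret local_transition G "level s" 2 "transition A C a s"
    by (rule local_transition_level[OF C R s(2)])
  have val: "holonomy p = Res A G a Y \<omega> {C} \<zeta>"
    if \<zeta>: "\<zeta> \<in> carrier (pi1_infinity A a r0 Y \<omega>)" and "s \<le> s'" "t \<in> base_times (level s') \<omega>" "p \<in> \<zeta> s' t" for \<zeta> s' t p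
  proof -
    obtain t0 p0 where p0: "t0 \<in> base_times (level s) \<omega>" "p0 \<in> \<zeta> s t0"
      by (rule loop_exists[OF \<zeta> s(1)]) (rule that)
    have "holonomy p = holonomy p0"
      by (rule holonomy_const[OF local_transition_axioms \<zeta> s(1) p0 that(2-4)])
    then show ?thesis
      using value_on_holonomy[OF C R s(2,1) \<zeta> p0] value_on_iff(1)[OF C \<zeta>] by simp
  qed
  show ?thesis
  proof (rule cocycle_value_iff[OF C R s(2,1)])
    fix s' t assume s': "s \<le> s'" and t: "t \<in> base_times (level s') \<omega>"
    have r0: "r0 \<le> s'" using s s' by simp
    note X = pi1_infinityD(1)[OF \<xi> r0 t] pi1_infinityD(1)[OF \<eta> r0 t]
    note eq = pi1_infinity_mult[OF r0 t, of \<xi> \<eta>]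
    show "(\<xi> \<otimes>\<^bsub>pi1_infinity A a r0 Y \<omega>\<^esub> \<eta>) s' t \<in> carrier (pi1 (level s') (\<omega> t))"
      unfolding eq by (rule pi1_mult_closed[OF X])
    fix p assume "p \<in> (\<xi> \<otimes>\<^bsub>pi1_infinity A a r0 Y \<omega>\<^esub> \<eta>) s' t"
    moreover obtain g h where g: "g \<in> \<xi> s' t" and h: "h \<in> \<eta> s' t"
      using pi1_nonempty[OF X(1)] pi1_nonempty[OF X(2)] by blast
    ultimately have "homotopic_paths (level s') (g +++ h) p"
      unfolding eq pi1_mult[OF X g h] by (simp add: path_class_def)
    then have "homotopic_paths (level s) (g +++ h) p"
      by (rule homotopic_paths_subset[OF _ level_complex_antimono[OF s']])
    then have "holonomy p = holonomy (g +++ h)"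
      by (simp add: holonomy_homotopic)
    also have "\<dots> = holonomy h \<otimes> holonomy g"
      using pi1_loop[OF X(1) g] pi1_loop[OF X(2) h] level_complex_antimono[OF s', of A a Y]
      by (intro holonomy_join) auto
    also have "\<dots> = Res A G a Y \<omega> {C} \<xi> \<otimes> Res A G a Y \<omega> {C} \<eta>"
      using val[OF \<xi> s' t g] val[OF \<eta> s' t h] value_on_iff(2)[OF C] \<xi> \<eta> by (simp add: m_comm)
    finally show "holonomy p = Res A G a Y \<omega> {C} \<xi> \<otimes> Res A G a Y \<omega> {C} \<eta>" .
  qed
qed

section \<open>Products of cocycles and trivial cocycles\<close>

lemma mult_cocycle_apply:
  "b \<in> A \<Longrightarrow> (C \<otimes>\<^bsub>cocycle_group A G\<^esub> C') (z, b) = C (z, b) \<otimes> C' (z, b)"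
  by (simp add: cocycle_group_def)

lemma cocycle_mult_closed:
  assumes C: "C \<in> cocycles A G" and C': "C' \<in> cocycles A G"
  shows "C \<otimes>\<^bsub>cocycle_group A G\<^esub> C' \<in> cocycles A G"
  unfolding cocycles_def mem_Collect_eq
proof (intro conjI allI ballI)
  let ?Z = "prod_topology (discrete_topology (UNIV :: (int ^ 'd) set)) (subtopology config_topology A)"
  show "C \<otimes>\<^bsub>cocycle_group A G\<^esub> C' \<in> extensional (UNIV \<times> A)"
    by (simp add: cocycle_group_def)
  have "continuous_map ?Z (discrete_topology (carrier G)) C" "continuous_map ?Z (discrete_topology (carrier G)) C'"
    using C C' by (simp_all add: cocycles_def)
  then have "continuous_map ?Z (prod_topology (discrete_topology (carrier G)) (discrete_topology (carrier G)))
      (\<lambda>p. (C p, C' p))"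
    by (rule continuous_map_pairedI)
  moreover have "continuous_map (prod_topology (discrete_topology (carrier G)) (discrete_topology (carrier G)))
      (discrete_topology (carrier G)) (\<lambda>(x, y). x \<otimes> y)"
    unfolding prod_topology_discrete_topology[symmetric] by auto
  ultimately have "continuous_map ?Z (discrete_topology (carrier G)) ((\<lambda>(x, y). x \<otimes> y) \<circ> (\<lambda>p. (C p, C' p)))"
    by (rule continuous_map_compose)
  then show "continuous_map ?Z (discrete_topology (carrier G)) (C \<otimes>\<^bsub>cocycle_group A G\<^esub> C')"
    by (rule continuous_map_eq) (auto simp: cocycle_group_def)
next
  fix y z b assume b: "b \<in> A"
  note cl = cocycle_closed[OF C] cocycle_closed[OF C']
  note bz = shift_mem[OF subshift b, of z]
  show "(C \<otimes>\<^bsub>cocycle_group A G\<^esub> C') (y + z, b) =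
      (C \<otimes>\<^bsub>cocycle_group A G\<^esub> C') (y, shift z b) \<otimes> (C \<otimes>\<^bsub>cocycle_group A G\<^esub> C') (z, b)"
    unfolding mult_cocycle_apply[OF b] mult_cocycle_apply[OF bz] cocycle_add[OF C b] cocycle_add[OF C' b]
    using cl[OF b] cl[OF bz] by (simp add: m_ac)
qed

lemma window_mult:
  assumes "window A C R" and "window A C' R"
  shows "window A (C \<otimes>\<^bsub>cocycle_group A G\<^esub> C') R"
  unfolding window_def determined_def
proof (intro ballI impI)
  fix w :: "int ^ 'd" and b b' assume w: "w \<in> box0 2" and b: "b \<in> A" "b' \<in> A" "\<forall>w\<in>box0 R. b w = b' w"
  have "C (w, b) = C (w, b')" "C' (w, b) = C' (w, b')"
    using assms w b unfolding window_def determined_def by blast+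
  then show "(C \<otimes>\<^bsub>cocycle_group A G\<^esub> C') (w, b) = (C \<otimes>\<^bsub>cocycle_group A G\<^esub> C') (w, b')"
    by (simp add: mult_cocycle_apply b(1,2))
qed

lemma extension_level:
  assumes "x \<in> level s" and "s > 0"
  shows "extension A a s (nearest x) \<in> A" and "nearest x \<in> good_sites A a s"
proof -
  show x: "nearest x \<in> good_sites A a s"
    using nearest_in[OF assms(1)[unfolded level_complex_def]] by blast
  show "extension A a s (nearest x) \<in> A" by (rule extension(1)[OF x assms(2)])
qed

lemma Res_holonomy:
  assumes C: "C \<in> cocycles A G" and "window A C R" "R + 2 \<le> s" "r0 \<le> s"
    and \<xi>: "\<xi> \<in> carrier (pi1_infinity A a r0 Y \<omega>)" and "t \<in> base_times (level s) \<omega>" "p \<in> \<xi> s t"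
  shows "Res A G a Y \<omega> {C} \<xi> = hol A G C a s p"
  using value_on_holonomy[OF assms] value_on_iff(1)[OF C \<xi>, of "hol A G C a s p"] by simp

text \<open>A window common to both factors serves for the product, so all three holonomies are read
  on the same loop at the same level.\<close>

lemma Res_cocycle_mult:
  assumes C: "C \<in> cocycles A G" and C': "C' \<in> cocycles A G" and \<xi>: "\<xi> \<in> carrier (pi1_infinity A a r0 Y \<omega>)"
  shows "Res A G a Y \<omega> {C \<otimes>\<^bsub>cocycle_group A G\<^esub> C'} \<xi> = Res A G a Y \<omega> {C} \<xi> \<otimes> Res A G a Y \<omega> {C'} \<xi>"
proof -
  let ?D = "C \<otimes>\<^bsub>cocycle_group A G\<^esub> C'"
  note D = cocycle_mult_closed[OF C C']
  obtain R1 R2 where "window A C R1" "window A C' R2"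
    using cocycle_window[OF subshift C] cocycle_window[OF subshift C'] by blast
  then obtain R where R: "window A C R" "window A C' R"
    using window_mono[of A C R1 "max R1 R2"] window_mono[of A C' R2 "max R1 R2"] by simp
  define s where "s = max r0 (R + 2)"
  have s: "r0 \<le> s" "R + 2 \<le> s" "s > 0" by (auto simp: s_def)
  obtain t p where p: "t \<in> base_times (level s) \<omega>" "p \<in> \<xi> s t" "path p" "path_image p \<subseteq> level s"
    by (rule loop_exists[OF \<xi> s(1)]) (rule that)
  have "hol A G ?D a s p = hol A G C a s p \<otimes> hol A G C' a s p"
  proof (rule holonomy_mult[OF comm_group_axioms local_transition_level[OF C R(1) s(2)]
        local_transition_level[OF C' R(2) s(2)] local_transition_level[OF D window_mult[OF R] s(2)] _ p(3,4)])
    fix x y assume "x \<in> level s"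
    then show "transition A ?D a s x y = transition A C a s x y \<otimes> transition A C' a s x y"
      unfolding transition_def using extension_level(1)[OF _ s(3)] by (intro mult_cocycle_apply)
  qed
  then show ?thesis
    unfolding Res_holonomy[OF C R(1) s(2,1) \<xi> p(1,2)] Res_holonomy[OF C' R(2) s(2,1) \<xi> p(1,2)]
      Res_holonomy[OF D window_mult[OF R] s(2,1) \<xi> p(1,2)] .
qed

text \<open>For a trivial cocycle, \<open>h z * b(\<sigma>\<^sup>z a)\<^sup>-\<^sup>1\<close> is a potential of the transition function.\<close>

lemma Res_trivial:
  assumes "C \<in> trivial_cocycles A G" and \<xi>: "\<xi> \<in> carrier (pi1_infinity A a r0 Y \<omega>)"
  shows "Res A G a Y \<omega> {C} \<xi> = \<one>"
proof -
  obtain h where C: "C \<in> cocycles A G" and h: "h \<in> hom lattice_group G"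
    and "cohomologous A G C (\<lambda>(z, a). h z)"
    using assms(1) unfolding trivial_cocycles_def by blast
  then obtain f where f: "continuous_map (subtopology config_topology A) (discrete_topology (carrier G)) f"
    and eq: "\<And>z b. b \<in> A \<Longrightarrow> h z = f (shift z b) \<otimes> C (z, b) \<otimes> inv (f b)"
    unfolding cohomologous_def by auto
  have f_closed: "f b \<in> carrier G" if "b \<in> A" for b
    using f that unfolding continuous_map_def by (auto simp: Pi_iff)
  have h_closed: "h z \<in> carrier G" for z
    using hom_in_carrier[OF h] by (simp add: lattice_group_def)
  have h_add: "h (y + z) = h y \<otimes> h z" for y z
    using hom_mult[OF h, of y z] by (simp add: lattice_group_def)
  obtain R1 where R1: "window A C R1" using cocycle_window[OF subshift C] by blast
  obtain R2 where R2: "determined A R2 f"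
    using continuous_determined[OF _ f] subshift unfolding subshift_def by blast
  \<comment> \<open>The coboundary function \<open>f\<close> has to be readable from the same box as
    \<open>C\<close>, so that extensions and their shifts are interchangeable in it too.\<close>
  define R where "R = max R1 R2"
  have R: "window A C R" "determined A R f"
    using window_mono[OF R1] determined_mono[OF R2] by (simp_all add: R_def)
  define s where "s = max r0 (R + 2)"
  have s: "r0 \<le> s" "R + 2 \<le> s" "s > 0" "R \<le> s" by (auto simp: s_def)
  interpret local_transition G "level s" 2 "transition A C a s"
    by (rule local_transition_level[OF C R(1) s(2)])
  obtain t p where p: "t \<in> base_times (level s) \<omega>" "p \<in> \<xi> s t" "path p" "path_image p \<subseteq> level s"
      "pathfinish p = pathstart p"
    by (rule loop_exists[OF \<xi> s(1)]) (rule that)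
  \<comment> \<open>The extension at the nearest site stands in for the shift of \<open>a\<close>,
    which may lie outside \<open>A\<close>, where \<open>f\<close> carries no information.\<close>
  define F where "F x = h (nearest x) \<otimes> inv (f (extension A a s (nearest x)))" for x
  have F_closed: "F x \<in> carrier G" if "x \<in> level s" for x
    unfolding F_def using h_closed f_closed[OF extension_level(1)[OF that s(3)]] by simp
  have "F y = transition A C a s x y \<otimes> F x" if xy: "x \<in> level s" "y \<in> level s" "dist x y < 2" for x y
  proof -
    let ?u = "nearest x" and ?v = "nearest y" and ?e = "extension A a s"
    note u = extension_level[OF xy(1) s(3)] and v = extension_level[OF xy(2) s(3)]
    note e' = shift_mem[OF subshift u(1), of "?v - ?u"]
    have "?e ?v k = shift (?v - ?u) (?e ?u) k" if k: "k \<in> box0 R" for k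
      using extension(2)[OF v(2) s(3) subsetD[OF box0_mono[OF s(4)] k]]
        extension_shift[OF u(2) s(3) nearest_diff[OF xy(3)] s(2) k] by simp
    then have fe: "f (?e ?v) = f (shift (?v - ?u) (?e ?u))"
      by (rule determinedD[OF R(2) v(1) e'])
    have "h ?v = h (?v - ?u) \<otimes> h ?u"
      using h_add[of "?v - ?u" ?u] by simp
    also have "h (?v - ?u) = f (?e ?v) \<otimes> C (?v - ?u, ?e ?u) \<otimes> inv (f (?e ?u))"
      using eq[OF u(1)] fe by simp
    finally have hv: "h ?v = f (?e ?v) \<otimes> C (?v - ?u, ?e ?u) \<otimes> inv (f (?e ?u)) \<otimes> h ?u" .
    note cl = f_closed[OF u(1)] f_closed[OF v(1)] h_closed[of ?u] cocycle_closed[OF C u(1), of "?v - ?u"]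
    have "f (?e ?v) \<otimes> C (?v - ?u, ?e ?u) \<otimes> inv (f (?e ?u)) \<otimes> h ?u \<otimes> inv (f (?e ?v)) =
        f (?e ?v) \<otimes> (C (?v - ?u, ?e ?u) \<otimes> (h ?u \<otimes> inv (f (?e ?u)))) \<otimes> inv (f (?e ?v))"
      using cl by (simp add: m_ac)
    also have "\<dots> = C (?v - ?u, ?e ?u) \<otimes> (h ?u \<otimes> inv (f (?e ?u)))"
      using cl by (intro conj_eq) simp_all
    finally show ?thesis
      unfolding F_def transition_def hv .
  qed
  then have "holonomy p = F (pathfinish p) \<otimes> inv (F (pathstart p))"
    using p(4) by (intro holonomy_potential[OF p(3,4)] F_closed) blast+
  also have "\<dots> = \<one>"
    using F_closed p(4,5) by (metis pathstart_in_path_image r_inv subsetD)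
  finally show ?thesis
    unfolding Res_holonomy[OF C R(1) s(2,1) \<xi> p(1,2)] .
qed

text \<open>This makes the cosets of the trivial cocycles nonempty, as \<open>Res_eqI\<close>
  demands.\<close>

lemma one_trivial_cocycle: "(\<lambda>p\<in>UNIV \<times> A. \<one>) \<in> trivial_cocycles A G"
proof -
  let ?Z = "prod_topology (discrete_topology (UNIV :: (int ^ 'd) set)) (subtopology config_topology A)"
  have "continuous_map ?Z (discrete_topology (carrier G)) (\<lambda>_. \<one>)" by simp
  then have "continuous_map ?Z (discrete_topology (carrier G)) (\<lambda>p\<in>UNIV \<times> A. \<one>)"
    by (rule continuous_map_eq) auto
  then have "(\<lambda>p\<in>UNIV \<times> A. \<one>) \<in> cocycles A G"
    using shift_mem[OF subshift] by (simp add: cocycles_def)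
  moreover have "(\<lambda>_ :: int ^ 'd. \<one>) \<in> hom lattice_group G"
    by (simp add: hom_def)
  moreover have "cohomologous A G (\<lambda>p\<in>UNIV \<times> A. \<one>) (\<lambda>(z, a). \<one>)"
    unfolding cohomologous_def by (intro exI[of _ "\<lambda>_. \<one>"]) simp
  ultimately show ?thesis
    unfolding trivial_cocycles_def by (intro CollectI conjI bexI[of _ "\<lambda>_ :: int ^ 'd. \<one>"])
qed

section \<open>Passage to cohomology classes\<close>

abbreviation coset :: "('a, 'd, 'g) cochain \<Rightarrow> ('a, 'd, 'g) cochain set" where
  "coset C \<equiv> trivial_cocycles A G #>\<^bsub>cocycle_group A G\<^esub> C"

text \<open>A member of the coset is a trivial cocycle times \<open>C\<close>; the residue is
  multiplicative and the trivial factor contributes the unit.\<close>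

lemma coset_cocycle:
  assumes C: "C \<in> cocycles A G" and D: "D \<in> coset C"
  shows "D \<in> cocycles A G"
    and "\<xi> \<in> carrier (pi1_infinity A a r0 Y \<omega>) \<Longrightarrow> Res A G a Y \<omega> {D} \<xi> = Res A G a Y \<omega> {C} \<xi>"
proof -
  obtain T where T: "T \<in> trivial_cocycles A G" and D: "D = T \<otimes>\<^bsub>cocycle_group A G\<^esub> C"
    using D unfolding r_coset_def by blast
  have Tc: "T \<in> cocycles A G" using T unfolding trivial_cocycles_def by blast
  show "D \<in> cocycles A G" unfolding D by (rule cocycle_mult_closed[OF Tc C])
  assume \<xi>: "\<xi> \<in> carrier (pi1_infinity A a r0 Y \<omega>)"
  show "Res A G a Y \<omega> {D} \<xi> = Res A G a Y \<omega> {C} \<xi>"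
    unfolding D Res_cocycle_mult[OF Tc C \<xi>] Res_trivial[OF T \<xi>]
    using value_on_iff(2)[OF C \<xi>] by simp
qed

lemma coset_nonempty: "coset C \<noteq> {}"
  using one_trivial_cocycle unfolding r_coset_def by blast

lemma Res_coset:
  assumes C: "C \<in> cocycles A G" and \<xi>: "\<xi> \<in> carrier (pi1_infinity A a r0 Y \<omega>)"
  shows "Res A G a Y \<omega> (coset C) \<xi> = Res A G a Y \<omega> {C} \<xi>"
proof (rule Res_eqI[OF coset_nonempty])
  fix D g assume D: "D \<in> coset C"
  show "value_on D \<xi> g \<longleftrightarrow> g = Res A G a Y \<omega> {C} \<xi>"
    unfolding value_on_iff(1)[OF coset_cocycle(1)[OF C D] \<xi>] coset_cocycle(2)[OF C D \<xi>] ..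
qed

text \<open>The quotient multiplies cosets as sets, so the argument runs over an arbitrary product
  of members; the value is the same for each.\<close>

lemma Res_coset_mult:
  assumes C: "C \<in> cocycles A G" and C': "C' \<in> cocycles A G" and \<xi>: "\<xi> \<in> carrier (pi1_infinity A a r0 Y \<omega>)"
  shows "Res A G a Y \<omega> (coset C <#>\<^bsub>cocycle_group A G\<^esub> coset C') \<xi> =
    Res A G a Y \<omega> {C} \<xi> \<otimes> Res A G a Y \<omega> {C'} \<xi>"
proof (rule Res_eqI)
  show "coset C <#>\<^bsub>cocycle_group A G\<^esub> coset C' \<noteq> {}"
    using coset_nonempty[of C] coset_nonempty[of C'] unfolding set_mult_def by blast
  fix D g assume "D \<in> coset C <#>\<^bsub>cocycle_group A G\<^esub> coset C'"
  then obtain E E' where E: "E \<in> coset C" and E': "E' \<in> coset C'" and D: "D = E \<otimes>\<^bsub>cocycle_group A G\<^esub> E'"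
    unfolding set_mult_def by blast
  note c = coset_cocycle(1)[OF C E] coset_cocycle(1)[OF C' E']
  show "value_on D \<xi> g \<longleftrightarrow> g = Res A G a Y \<omega> {C} \<xi> \<otimes> Res A G a Y \<omega> {C'} \<xi>"
    unfolding D value_on_iff(1)[OF cocycle_mult_closed[OF c] \<xi>] Res_cocycle_mult[OF c \<xi>]
      coset_cocycle(2)[OF C E \<xi>] coset_cocycle(2)[OF C' E' \<xi>] ..
qed

lemma H1_dy_carrierE:
  assumes "X \<in> carrier (H1_dy A G)"
  obtains C where "C \<in> cocycles A G" and "X = coset C"
proof -
  have "carrier (cocycle_group A G) = cocycles A G" by (simp add: cocycle_group_def)
  then show thesis
    using assms that unfolding H1_dy_def FactGroup_def RCOSETS_def by auto
qed

lemma Res_hom_cohomology: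
  assumes \<xi>: "\<xi> \<in> carrier (pi1_infinity A a r0 Y \<omega>)"
  shows "(\<lambda>X. Res A G a Y \<omega> X \<xi>) \<in> hom (H1_dy A G) G"
proof (rule homI)
  fix X assume "X \<in> carrier (H1_dy A G)"
  then obtain C where C: "C \<in> cocycles A G" and X: "X = coset C" by (rule H1_dy_carrierE)
  show "Res A G a Y \<omega> X \<xi> \<in> carrier G"
    unfolding X Res_coset[OF C \<xi>] by (rule value_on_iff(2)[OF C \<xi>])
  fix X' assume "X' \<in> carrier (H1_dy A G)"
  then obtain C' where C': "C' \<in> cocycles A G" and X': "X' = coset C'" by (rule H1_dy_carrierE)
  have "X \<otimes>\<^bsub>H1_dy A G\<^esub> X' = coset C <#>\<^bsub>cocycle_group A G\<^esub> coset C'"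
    unfolding X X' H1_dy_def FactGroup_def by simp
  then show "Res A G a Y \<omega> (X \<otimes>\<^bsub>H1_dy A G\<^esub> X') \<xi> = Res A G a Y \<omega> X \<xi> \<otimes> Res A G a Y \<omega> X' \<xi>"
    unfolding X X' by (simp only: Res_coset_mult[OF C C' \<xi>] Res_coset[OF C \<xi>] Res_coset[OF C' \<xi>])
qed

lemma Res_coset_loop_mult:
  assumes C: "C \<in> cocycles A G" and \<xi>: "\<xi> \<in> carrier (pi1_infinity A a r0 Y \<omega>)"
    and \<eta>: "\<eta> \<in> carrier (pi1_infinity A a r0 Y \<omega>)"
  shows "Res A G a Y \<omega> (coset C) (\<xi> \<otimes>\<^bsub>pi1_infinity A a r0 Y \<omega>\<^esub> \<eta>) =
    Res A G a Y \<omega> {C} \<xi> \<otimes> Res A G a Y \<omega> {C} \<eta>"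
proof (rule Res_eqI[OF coset_nonempty])
  fix D g assume D: "D \<in> coset C"
  show "value_on D (\<xi> \<otimes>\<^bsub>pi1_infinity A a r0 Y \<omega>\<^esub> \<eta>) g \<longleftrightarrow>
      g = Res A G a Y \<omega> {C} \<xi> \<otimes> Res A G a Y \<omega> {C} \<eta>"
    unfolding value_on_loop_mult[OF coset_cocycle(1)[OF C D] \<xi> \<eta>]
      coset_cocycle(2)[OF C D \<xi>] coset_cocycle(2)[OF C D \<eta>] ..
qed

lemma Res_hom_loops:
  assumes "X \<in> carrier (H1_dy A G)"
  shows "(\<lambda>\<xi>. Res A G a Y \<omega> X \<xi>) \<in> hom (pi1_infinity A a r0 Y \<omega>) G"
proof (rule homI)
  obtain C where C: "C \<in> cocycles A G" and X: "X = coset C"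
    using assms by (rule H1_dy_carrierE)
  fix \<xi> assume \<xi>: "\<xi> \<in> carrier (pi1_infinity A a r0 Y \<omega>)"
  show "Res A G a Y \<omega> X \<xi> \<in> carrier G"
    unfolding X Res_coset[OF C \<xi>] by (rule value_on_iff(2)[OF C \<xi>])
  fix \<eta> assume \<eta>: "\<eta> \<in> carrier (pi1_infinity A a r0 Y \<omega>)"
  show "Res A G a Y \<omega> X (\<xi> \<otimes>\<^bsub>pi1_infinity A a r0 Y \<omega>\<^esub> \<eta>) = Res A G a Y \<omega> X \<xi> \<otimes> Res A G a Y \<omega> X \<eta>"
    unfolding X Res_coset[OF C \<xi>] Res_coset[OF C \<eta>] by (rule Res_coset_loop_mult[OF C \<xi> \<eta>])
qed

end

text \<open>The equivalence in the abelian part ties the definite description \<open>Res\<close> to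
  the relation \<open>cocycle_value\<close>: a cocycle has exactly one value on
  \<open>\<xi>\<close>, and this value is shared by its whole class.\<close>

theorem theorem2p8:
  fixes A :: "('a::finite, 'd::finite) config set"
    and G :: "('g, 'm) monoid_scheme"
    and a :: "('a, 'd) config"
    and r0 :: nat
    and Y :: "(int ^ 'd) set"
    and \<omega> :: "real \<Rightarrow> real ^ 'd"
  assumes "subshift A"
    and "group G"
    and "a \<in> defect_configs A"
    and "projective_codim2_defect A a"
    and "unique_projective A a r0 Y"
    and "proper_base_ray A a r0 Y \<omega>"
  shows
    "((\<exists>C\<in>cocycles A G. \<exists>\<xi>\<in>carrier (pi1_infinity A a r0 Y \<omega>). \<exists>g.
         cocycle_value A G a Y \<omega> C \<xi> g \<and> g \<noteq> \<one>\<^bsub>G\<^esub>)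
       \<longrightarrow> essential_defect A a)
     \<and> (comm_group G \<longrightarrow>
         (\<forall>C\<in>cocycles A G. \<forall>\<xi>\<in>carrier (pi1_infinity A a r0 Y \<omega>). \<forall>g.
            cocycle_value A G a Y \<omega> C \<xi> g \<longleftrightarrow>
            g = Res A G a Y \<omega> (trivial_cocycles A G #>\<^bsub>cocycle_group A G\<^esub> C) \<xi>)
         \<and> (\<forall>\<xi>\<in>carrier (pi1_infinity A a r0 Y \<omega>).
              (\<lambda>X. Res A G a Y \<omega> X \<xi>) \<in> hom (H1_dy A G) G)
         \<and> (\<forall>X\<in>carrier (H1_dy A G).
              (\<lambda>\<xi>. Res A G a Y \<omega> X \<xi>) \<in> hom (pi1_infinity A a r0 Y \<omega>) G))"
proof (intro conjI impI)
  assume "\<exists>C\<in>cocycles A G. \<exists>\<xi>\<in>carrier (pi1_infinity A a r0 Y \<omega>). \<exists>g.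
         cocycle_value A G a Y \<omega> C \<xi> g \<and> g \<noteq> \<one>\<^bsub>G\<^esub>"
  then show "essential_defect A a"
    using residue_imp_essential[OF assms(2,1)] by blast
next
  assume "comm_group G"
  then interpret residue_setting G A a r0 Y \<omega>
    by (rule residue_setting.intro[OF _ residue_setting_axioms.intro[OF assms(1,6)]])
  show "\<forall>C\<in>cocycles A G. \<forall>\<xi>\<in>carrier (pi1_infinity A a r0 Y \<omega>). \<forall>g.
            cocycle_value A G a Y \<omega> C \<xi> g \<longleftrightarrow>
            g = Res A G a Y \<omega> (trivial_cocycles A G #>\<^bsub>cocycle_group A G\<^esub> C) \<xi>"
    using value_on_iff(1) Res_coset by simp
  show "\<forall>\<xi>\<in>carrier (pi1_infinity A a r0 Y \<omega>). (\<lambda>X. Res A G a Y \<omega> X \<xi>) \<in> hom (H1_dy A G) G"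
    using Res_hom_cohomology by blast
  show "\<forall>X\<in>carrier (H1_dy A G). (\<lambda>\<xi>. Res A G a Y \<omega> X \<xi>) \<in> hom (pi1_infinity A a r0 Y \<omega>) G"
    using Res_hom_loops by blast
qed

end
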